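(* Let $(K,\mathrm{val})$ be an algebraically closed field with valuation and let $\Bbbk$ be its residue field. Let $X$ be a general smooth tropical cubic surface containing a family of tropical lines $(L_a)_{a>0}$. Suppose that either (1) the family $(L_a)_{a>0}$ is of type 3I-1 and $\mathrm{char}(\Bbbk)\neq 2$, or (2) the family $(L_a)_{a>0}$ is of type 3I-2. Then for every homogeneous cubic polynomial $f\in K[x_0,x_1,x_2,x_3]$ with $X=V(\mathrm{trop}(f))$ the family cannot be realized by lines on $V(f)$; that is, for every $a>0$ there is no line $\ell\subset V(f)\subset\mathbb{P}^3_K$ with $\mathrm{trop}(\ell)=L_a$ (the lifting multiplicity of every non-degenerate member of the family is zero).
   Context: Tropical conventions. The min-convention is used, and everything lives in $\mathbb{R}^4/\mathbb{R}\mathbf{1}$, $\mathbf 1=(1,1,1,1)$, with $e_0,\dots,e_3$ the images of the standard basis vectors. For $f=\sum_u c_u x^u\in K[x_0,\dots,x_3]$ homogeneous, $\mathrm{trop}(f)(w)=\min_u(\mathrm{val}(c_u)+u\cdot w)$, and $V(\mathrm{trop}(f))$ is the set of $w$ where this minimum is attained at least twice. For a line $\ell\subset\mathbb{P}^3_K$, $\mathrm{trop}(\ell)\subset\mathbb{R}^4/\mathbb{R}\mathbf 1$ denotes its tropicalization. Smooth tropical cubic surfaces. Let $3\Delta_3=\mathrm{conv}\{(0,0,0),(3,0,0),(0,3,0),(0,0,3)\}$; a lattice point $(u_1,u_2,u_3)\in 3\Delta_3$ is identified with the cubic monomial $x_0^{3-u_1-u_2-u_3}x_1^{u_1}x_2^{u_2}x_3^{u_3}$.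 For $i=0,\dots,3$ let $F_i$ be the facet of $3\Delta_3$ of monomials not divisible by $x_i$. A tropical cubic surface is $X=V(F)$ for a tropical polynomial $F=\min_u(\omega_u+u\cdot w)$ with Newton polytope $3\Delta_3$; it is smooth if the dual regular subdivision of $3\Delta_3$ induced by $(\omega_u)$ is a unimodular triangulation (all maximal cells are lattice tetrahedra of volume $\frac16$). Vertices of $X$ are dual to the maximal tetrahedra. General. A statement holds for "general" smooth tropical cubic surfaces if, for every regular unimodular triangulation $T$ of $3\Delta_3$, there is an open dense subset $U_T$ of the (open) secondary cone of $T$ such that it holds for all $X$ whose coefficient vector $\omega$ lies in $U_T$. Tropical lines. A non-degenerate tropical line in $\mathbb{R}^4/\mathbb{R}\mathbf 1$ consists, for a partition $\{0,1,2,3\}=\{i,j\}\sqcup\{k,l\}$, of a bounded segment of positive length from a point $v$ to $v+a(e_i+e_j)$, $a>0$, together with rays from $v$ in directions $e_k,e_l$ and rays from $v+a(e_i+e_j)$ in directions $e_i,e_j$. It is degenerate if the bounded segment has length zero ($a=0$), so it is the union of the four rays from $v$ in directions $e_0,\dots,e_3$. Families of motif 3I. A family $(L_a)_{a\ge 0}$ of tropical lines on $X$ has motif 3I if there is a vertex $v$ of $X$ and a partition $\{i,j\}\sqcup\{k,l\}$ such that $L_a\subset X$ is the tropical line above with vertices $v$ and $v+a(e_i+e_j)$, and its dual motif is the tetrahedron dual to $v$, which is a 4-exit tetrahedron: a unimodular tetrahedron having one edge in $F_i\cap F_j$ and at least one-dimensional intersection with both $F_k$ and $F_l$. (The dual motif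 of a tropical line $L\subset X$ is the union over $p\in L$ of the cells dual to the minimal cell of $X$ containing $p$.) The family is of type 3I-1 if its dual motif is, up to a permutation of the homogeneous coordinates $x_0,\dots,x_3$, the tetrahedron with vertices $(0,0,0),(0,0,1),(2,1,0),(1,0,2)$ (monomials $x_0^3,x_0^2x_3,x_1^2x_2,x_1x_3^2$). It is of type 3I-2 if its dual motif is, up to such a permutation, the tetrahedron with vertices $(0,0,0),(0,0,1),(2,1,0),(1,1,1)$ (monomials $x_0^3,x_0^2x_3,x_1^2x_2,x_1x_2x_3$). In these representatives $\{i,j\}=\{1,2\}$ and $\{k,l\}=\{0,3\}$. Lifting multiplicity. For a tropical line $L\subset X$ and $f$ with $X=V(\mathrm{trop}(f))$, the lifting multiplicity of $L$ with respect to $V(f)$ is the number of lines $\ell\subset V(f)$ with $\mathrm{trop}(\ell)=L$. *)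

theory Defs
  imports
    "HOL-Analysis.Analysis"
    "HOL-Library.Poly_Mapping"
    "HOL-Algebra.QuotRing"
    "HOL-Computational_Algebra.Polynomial"
begin

section \<open>Valuations and residue fields\<close>

text \<open>A valuation $K \to \mathbb{R} \cup \{\infty\}$ is given by its real-valued restriction to
  $K \setminus \{0\}$; the junk value \<open>v 0\<close> is never used.\<close>

definition is_valuation :: "('k::field \<Rightarrow> real) \<Rightarrow> bool" where
  "is_valuation v \<longleftrightarrow>
     (\<forall>x y. x \<noteq> 0 \<longrightarrow> y \<noteq> 0 \<longrightarrow> v (x * y) = v x + v y) \<and>
     (\<forall>x y. x \<noteq> 0 \<longrightarrow> y \<noteq> 0 \<longrightarrow> x + y \<noteq> 0 \<longrightarrow> v (x + y) \<ge> min (v x) (v y))"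

definition valuation_ring :: "('k::field \<Rightarrow> real) \<Rightarrow> 'k ring" where
  "valuation_ring v =
     \<lparr>carrier = {x. x = 0 \<or> v x \<ge> 0}, mult = (*), one = 1, zero = 0, add = (+)\<rparr>"

definition valuation_ideal :: "('k::field \<Rightarrow> real) \<Rightarrow> 'k set" where
  "valuation_ideal v = {x. x = 0 \<or> v x > 0}"

definition residue_field :: "('k::field \<Rightarrow> real) \<Rightarrow> 'k set ring" where
  "residue_field v = valuation_ring v Quot valuation_ideal v"

definition ring_characteristic :: "('a, 'b) ring_scheme \<Rightarrow> nat" where
  "ring_characteristic R =
     (if \<exists>n>0. add_pow R (n::nat) \<one>\<^bsub>R\<^esub> = \<zero>\<^bsub>R\<^esub>
      then LEAST n. n > 0 \<and> add_pow R n \<one>\<^bsub>R\<^esub> = \<zero>\<^bsub>R\<^esub> else 0)"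

section \<open>Polynomials and lines in projective 3-space\<close>

text \<open>Coordinates are indexed by the four-element type \<open>4\<close>, with elements \<open>0, 1, 2, 3\<close>.
  An exponent vector has type \<open>nat^4\<close>, and $K[x_0,\dots,x_3]$ is \<open>(nat^4) \<Rightarrow>\<^sub>0 'k\<close>.\<close>

definition eval_poly :: "((nat^4) \<Rightarrow>\<^sub>0 'k::field) \<Rightarrow> 'k^4 \<Rightarrow> 'k" where
  "eval_poly f x =
     (\<Sum>u\<in>Poly_Mapping.keys f. Poly_Mapping.lookup f u * (\<Prod>i\<in>UNIV. (x $ i) ^ (u $ i)))"

definition homogeneous_of_degree :: "nat \<Rightarrow> ((nat^4) \<Rightarrow>\<^sub>0 'k::field) \<Rightarrow> bool" where
  "homogeneous_of_degree d f \<longleftrightarrow> (\<forall>u\<in>Poly_Mapping.keys f. (\<Sum>i\<in>UNIV. u $ i) = d)"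

text \<open>A line in $\mathbb{P}^3_K$ is represented by its cone, a two-dimensional subspace of $K^4$.\<close>

definition projective_line :: "('k::field^4) set \<Rightarrow> bool" where
  "projective_line l \<longleftrightarrow> vec.subspace l \<and> vec.dim l = 2"

definition vanishes_on :: "((nat^4) \<Rightarrow>\<^sub>0 'k::field) \<Rightarrow> ('k^4) set \<Rightarrow> bool" where
  "vanishes_on f l \<longleftrightarrow> (\<forall>x\<in>l. eval_poly f x = 0)"

section \<open>Tropicalization\<close>

text \<open>Subsets of $\mathbb{R}^4/\mathbb{R}\mathbf{1}$ are represented by their preimages in
  $\mathbb{R}^4$, that is, by sets invariant under translation by multiples of \<open>1 :: real^4\<close>.\<close>

definition pairing :: "nat^4 \<Rightarrow> real^4 \<Rightarrow> real" where
  "pairing u w = (\<Sum>i\<in>UNIV. real (u $ i) * w $ i)"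

definition min_attained_twice :: "'a set \<Rightarrow> ('a \<Rightarrow> real) \<Rightarrow> bool" where
  "min_attained_twice A g \<longleftrightarrow>
     (\<exists>u\<in>A. \<exists>u'\<in>A. u \<noteq> u' \<and> g u = Min (g ` A) \<and> g u' = Min (g ` A))"

definition trop_hypersurface ::
    "('k::field \<Rightarrow> real) \<Rightarrow> ((nat^4) \<Rightarrow>\<^sub>0 'k) \<Rightarrow> (real^4) set" where
  "trop_hypersurface v f =
     {w. min_attained_twice (Poly_Mapping.keys f) (\<lambda>u. v (Poly_Mapping.lookup f u) + pairing u w)}"

text \<open>The tropicalization of a line is the intersection of the tropical hypersurfaces of the
  forms in its homogeneous ideal. The zero form has to be left out, because
  \<open>trop_hypersurface v 0\<close> is empty.\<close>

definition trop_of_line :: "('k::field \<Rightarrow> real) \<Rightarrow> ('k^4) set \<Rightarrow> (real^4) set" where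
  "trop_of_line v l =
     (\<Inter>g \<in> {g. g \<noteq> 0 \<and> (\<exists>d. homogeneous_of_degree d g) \<and> vanishes_on g l}. trop_hypersurface v g)"

section \<open>Tropical cubic surfaces and their dual subdivisions\<close>

typedef cubic_monomial = "{u :: nat^4. (\<Sum>i\<in>UNIV. u $ i) = 3}"
  morphisms exponent cubic_monomial_of
proof
  show "(\<chi> i. if i = 0 then 3 else 0) \<in> {u :: nat^4. (\<Sum>i\<in>UNIV. u $ i) = 3}"
    by simp
qed

instance cubic_monomial :: finite
proof
  have "exponent ` UNIV \<subseteq> vec_lambda ` (UNIV \<rightarrow> {..3})"
  proof
    fix u :: "nat^4" assume "u \<in> exponent ` UNIV"
    then have s: "(\<Sum>i\<in>UNIV. u $ i) = 3"
      using exponent by auto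
    have "u $ i \<le> 3" for i
      using member_le_sum[of i UNIV "\<lambda>i. u $ i"] s by simp
    then show "u \<in> vec_lambda ` (UNIV \<rightarrow> {..3})"
      by (intro image_eqI[of _ _ "vec_nth u"]) auto
  qed
  moreover have "finite (vec_lambda ` (UNIV \<rightarrow> {..3}) :: (nat^4) set)"
    using finite_PiE[of "UNIV :: 4 set" "\<lambda>_. {..3::nat}"]
    by (simp add: PiE_def extensional_def)
  ultimately have "finite (exponent ` (UNIV :: cubic_monomial set))"
    by (rule finite_subset)
  then show "finite (UNIV :: cubic_monomial set)"
    by (rule finite_imageD) (meson exponent_inject injI)
qed

text \<open>A coefficient vector is \<open>\<omega> :: real^cubic_monomial\<close>; thus all 20 cubic monomials occur in
  the tropical polynomial \<open>trop_cubic \<omega>\<close>, and its Newton polytope is $3\Delta_3$.\<close>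

definition trop_term :: "real^cubic_monomial \<Rightarrow> real^4 \<Rightarrow> cubic_monomial \<Rightarrow> real" where
  "trop_term \<omega> w u = \<omega> $ u + pairing (exponent u) w"

definition trop_cubic :: "real^cubic_monomial \<Rightarrow> real^4 \<Rightarrow> real" where
  "trop_cubic \<omega> w = Min (range (trop_term \<omega> w))"

definition trop_surface :: "real^cubic_monomial \<Rightarrow> (real^4) set" where
  "trop_surface \<omega> = {w. min_attained_twice UNIV (trop_term \<omega> w)}"

definition lattice_point :: "nat^4 \<Rightarrow> real^3" where
  "lattice_point u = vector [real (u $ 1), real (u $ 2), real (u $ 3)]"

definition lattice_polytope :: "(nat^4) set \<Rightarrow> (real^3) set" where
  "lattice_polytope S = convex hull (lattice_point ` S)"

text \<open>The facet \<open>F\<^sub>i\<close> of $3\Delta_3$.\<close>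

definition facet :: "4 \<Rightarrow> (real^3) set" where
  "facet i = lattice_polytope {u. (\<Sum>m\<in>UNIV. u $ m) = 3 \<and> u $ i = 0}"

text \<open>The cells of the regular subdivision are the projections of the lower faces of the lifted
  points \<open>(u, \<omega>\<^sub>u)\<close>, that is, of the sets of lifted points minimizing a linear functional with
  last coordinate \<open>1\<close>. Such a functional is a point \<open>w\<close>. A cell is recorded by the set of
  lattice points whose lifts lie on the lower face. When this is the vertex set of a
  unimodular tetrahedron, the cell contains no other lattice points.\<close>

definition dual_cell :: "real^cubic_monomial \<Rightarrow> real^4 \<Rightarrow> (nat^4) set" where
  "dual_cell \<omega> w = exponent ` {u. trop_term \<omega> w u = trop_cubic \<omega> w}"

definition regular_subdivision :: "real^cubic_monomial \<Rightarrow> (nat^4) set set" where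
  "regular_subdivision \<omega> = range (dual_cell \<omega>)"

definition maximal_cells :: "(nat^4) set set \<Rightarrow> (nat^4) set set" where
  "maximal_cells T = {S \<in> T. \<forall>S'\<in>T. S \<subseteq> S' \<longrightarrow> S' = S}"

definition unimodular_tetrahedron :: "(nat^4) set \<Rightarrow> bool" where
  "unimodular_tetrahedron S \<longleftrightarrow> card S = 4 \<and> measure lebesgue (lattice_polytope S) = 1 / 6"

definition regular_unimodular_triangulation :: "(nat^4) set set \<Rightarrow> bool" where
  "regular_unimodular_triangulation T \<longleftrightarrow>
     (\<exists>\<omega>. T = regular_subdivision \<omega>) \<and> (\<forall>S\<in>maximal_cells T. unimodular_tetrahedron S)"

definition open_secondary_cone :: "(nat^4) set set \<Rightarrow> (real^cubic_monomial) set" where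
  "open_secondary_cone T = {\<omega>. regular_subdivision \<omega> = T}"

text \<open>\<open>trop_surface \<omega>\<close> is a smooth tropical cubic surface iff \<open>\<omega>\<close> lies in the open secondary cone of
  a regular unimodular triangulation. Genericity of a property of such surfaces:\<close>

definition holds_for_general_smooth_cubic :: "(real^cubic_monomial \<Rightarrow> bool) \<Rightarrow> bool" where
  "holds_for_general_smooth_cubic P \<longleftrightarrow>
     (\<forall>T. regular_unimodular_triangulation T \<longrightarrow>
        (\<exists>U. openin (top_of_set (open_secondary_cone T)) U \<and>
             open_secondary_cone T \<subseteq> closure U \<and> (\<forall>\<omega>\<in>U. P \<omega>)))"

section \<open>Tropical lines and motif 3I\<close>

abbreviation trop_e :: "4 \<Rightarrow> real^4" where
  "trop_e i \<equiv> axis i 1"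

text \<open>The translates by \<open>c *\<^sub>R 1\<close> make up the preimage in $\mathbb{R}^4$.\<close>

definition tropical_line :: "real^4 \<Rightarrow> real \<Rightarrow> 4 \<Rightarrow> 4 \<Rightarrow> 4 \<Rightarrow> 4 \<Rightarrow> (real^4) set" where
  "tropical_line p a i j k l =
     {q + c *\<^sub>R 1 | q c.
        (\<exists>t. 0 \<le> t \<and> t \<le> a \<and> q = p + t *\<^sub>R (trop_e i + trop_e j)) \<or>
        (\<exists>t\<ge>0. q = p + t *\<^sub>R trop_e k \<or> q = p + t *\<^sub>R trop_e l) \<or>
        (\<exists>t\<ge>0. q = p + a *\<^sub>R (trop_e i + trop_e j) + t *\<^sub>R trop_e i \<or>
               q = p + a *\<^sub>R (trop_e i + trop_e j) + t *\<^sub>R trop_e j)}"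

text \<open>The cell dual to the minimal cell of the surface containing \<open>p\<close> is spanned by the
  monomials attaining the minimum at \<open>p\<close>.\<close>

definition dual_motif :: "real^cubic_monomial \<Rightarrow> (real^4) set \<Rightarrow> (real^3) set" where
  "dual_motif \<omega> L = (\<Union>p\<in>L. lattice_polytope (dual_cell \<omega> p))"

definition surface_vertex :: "real^cubic_monomial \<Rightarrow> real^4 \<Rightarrow> bool" where
  "surface_vertex \<omega> p \<longleftrightarrow> dual_cell \<omega> p \<in> maximal_cells (regular_subdivision \<omega>)"

definition four_exit_tetrahedron :: "(nat^4) set \<Rightarrow> 4 \<Rightarrow> 4 \<Rightarrow> 4 \<Rightarrow> 4 \<Rightarrow> bool" where
  "four_exit_tetrahedron S i j k l \<longleftrightarrow>
     unimodular_tetrahedron S \<and>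
     (\<exists>u\<in>S. \<exists>u'\<in>S. u \<noteq> u' \<and>
        closed_segment (lattice_point u) (lattice_point u') \<subseteq> facet i \<inter> facet j) \<and>
     aff_dim (lattice_polytope S \<inter> facet k) \<ge> 1 \<and>
     aff_dim (lattice_polytope S \<inter> facet l) \<ge> 1"

definition motif_3I :: "real^cubic_monomial \<Rightarrow> (real \<Rightarrow> (real^4) set) \<Rightarrow> bool" where
  "motif_3I \<omega> L \<longleftrightarrow>
     (\<exists>p i j k l. surface_vertex \<omega> p \<and> distinct [i, j, k, l] \<and>
        four_exit_tetrahedron (dual_cell \<omega> p) i j k l \<and>
        (\<forall>a\<ge>0. L a = tropical_line p a i j k l \<and> L a \<subseteq> trop_surface \<omega> \<and>
                dual_motif \<omega> (L a) = lattice_polytope (dual_cell \<omega> p)))"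

definition exponent_vector :: "nat \<Rightarrow> nat \<Rightarrow> nat \<Rightarrow> nat \<Rightarrow> nat^4" where
  "exponent_vector a b c d =
     (\<chi> i. if i = 0 then a else if i = 1 then b else if i = 2 then c else d)"

definition tetrahedron_3I_1 :: "(nat^4) set" where
  "tetrahedron_3I_1 =
     {exponent_vector 3 0 0 0, exponent_vector 2 0 0 1,
      exponent_vector 0 2 1 0, exponent_vector 0 1 0 2}"

definition tetrahedron_3I_2 :: "(nat^4) set" where
  "tetrahedron_3I_2 =
     {exponent_vector 3 0 0 0, exponent_vector 2 0 0 1,
      exponent_vector 0 2 1 0, exponent_vector 0 1 1 1}"

definition permute_coordinates :: "(4 \<Rightarrow> 4) \<Rightarrow> nat^4 \<Rightarrow> nat^4" where
  "permute_coordinates \<pi> u = (\<chi> i. u $ \<pi> i)"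

definition type_3I ::
    "(nat^4) set \<Rightarrow> real^cubic_monomial \<Rightarrow> (real \<Rightarrow> (real^4) set) \<Rightarrow> bool" where
  "type_3I S \<omega> L \<longleftrightarrow> motif_3I \<omega> L \<and>
     (\<exists>\<pi>. bij \<pi> \<and> (\<forall>a\<ge>0. dual_motif \<omega> (L a) = lattice_polytope (permute_coordinates \<pi> ` S)))"

definition type_3I_1 :: "real^cubic_monomial \<Rightarrow> (real \<Rightarrow> (real^4) set) \<Rightarrow> bool" where
  "type_3I_1 = type_3I tetrahedron_3I_1"

definition type_3I_2 :: "real^cubic_monomial \<Rightarrow> (real \<Rightarrow> (real^4) set) \<Rightarrow> bool" where
  "type_3I_2 = type_3I tetrahedron_3I_2"

end

(* Near a vertex p, the surface and the initial form of f at p have the same tropical fan. Because the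
   dual tetrahedron is unimodular and meets all facets, this forces the monomials of the initial form
   to be exactly its four vertices. A line whose tropicalization has its first vertex at p and
   bounded edge of length a can be rescaled to (x_i, x_j, x_k, x_l) = (z, z + A, 1, 1 + z), where A
   has valuation a > 0, so the initial form has to vanish at (z, z, 1, 1 + z) over the residue field.
   In type 3I-1 the coefficient of z^2 is then twice the coefficient of x_1 x_3^2, and in type 3I-2
   the coefficient of z is that of x_0^2 x_3; both would have to be zero. *)
theory Submission
  imports Defs
begin

text \<open>The obstacle is that \<open>f\<close> and \<open>\<omega>\<close> are linked only
  through a set: their coefficients cannot be compared term by term, and \<open>f\<close> may lack
  monomials. The local fan at \<open>p\<close> a priori fixes the extreme exponents of the initial
  form only up to translation and dilation. Integral barycentric coordinates make the dilation
  factor a positive integer, a vertex on each facet makes the translation nonnegative, and the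
  common degree 3 then leaves only factor 1 and translation 0. The rescaling needs field elements
  with valuations \<open>p $ n + C\<close>. They are built from the coefficients of two linear forms
  vanishing on the line, whose valuations are read off along the four rays of its tropicalization.
  No map to the residue field is built: residual vanishing is membership in
  \<open>valuation_ideal v\<close>. The inequality a > 0 makes \<open>A\<close> residually zero; for
  a = 0 it would be a unit and its term could cancel the decisive one.\<close>

section \<open>Minima attained twice and their local structure\<close>

lemma min_attained_twice_iff:
  assumes "finite A"
  shows "min_attained_twice A g \<longleftrightarrow>
    (\<exists>u\<in>A. \<exists>u'\<in>A. u \<noteq> u' \<and> g u = g u' \<and> (\<forall>x\<in>A. g u \<le> g x))"
proof
  assume "min_attained_twice A g"
  then obtain u u' where "u \<in> A" "u' \<in> A" "u \<noteq> u'" "g u = Min (g ` A)" "g u' = Min (g ` A)"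
    unfolding min_attained_twice_def by blast
  then show "\<exists>u\<in>A. \<exists>u'\<in>A. u \<noteq> u' \<and> g u = g u' \<and> (\<forall>x\<in>A. g u \<le> g x)"
    using assms by (intro bexI[of _ u] bexI[of _ u']) auto
next
  assume "\<exists>u\<in>A. \<exists>u'\<in>A. u \<noteq> u' \<and> g u = g u' \<and> (\<forall>x\<in>A. g u \<le> g x)"
  then obtain u u' where u: "u \<in> A" "u' \<in> A" "u \<noteq> u'" "g u = g u'" "\<forall>x\<in>A. g u \<le> g x"
    by blast
  have "Min (g ` A) = g u"
    using assms u by (intro Min_eqI) auto
  then show "min_attained_twice A g"
    unfolding min_attained_twice_def using u by (intro bexI[of _ u] bexI[of _ u']) auto
qed

lemma min_attained_twice_image:
  assumes "finite A" "inj_on e A"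
  shows "min_attained_twice (e ` A) g \<longleftrightarrow> min_attained_twice A (\<lambda>u. g (e u))"
  unfolding min_attained_twice_iff[OF assms(1)] min_attained_twice_iff[OF finite_imageI[OF assms(1)]]
  using assms(2) by (auto simp: inj_on_eq_iff)

lemma min_attained_twice_cong:
  assumes "\<And>u. u \<in> A \<Longrightarrow> g u = g' u"
  shows "min_attained_twice A g \<longleftrightarrow> min_attained_twice A g'"
proof -
  have "g ` A = g' ` A" using assms by (rule image_cong[OF refl])
  then show ?thesis unfolding min_attained_twice_def using assms by auto
qed

text \<open>A small perturbation cannot let a non-minimizer of \<open>g\<close> catch up, and on the
  minimizers \<open>g\<close> is constant, so only \<open>h\<close> decides. Geometrically, the germ
  of a tropical hypersurface at a point is the fan of its initial terms there.\<close>

lemma min_attained_twice_near: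
  fixes g h :: "'a \<Rightarrow> real"
  assumes A: "finite A" and S: "S = {u \<in> A. \<forall>x\<in>A. g u \<le> g x}"
  shows "\<forall>\<^sub>F \<epsilon> in at_right 0.
    min_attained_twice A (\<lambda>u. g u + \<epsilon> * h u) \<longleftrightarrow> min_attained_twice S h"
proof -
  have fS: "finite S" using A S by simp
  have "\<forall>\<^sub>F \<epsilon> in at_right 0. g u + \<epsilon> * h u < g x + \<epsilon> * h x" if "u \<in> S" "x \<in> A - S" for u x
  proof -
    have "g u < g x" using that S by (force simp: not_le intro: le_less_trans)
    moreover have "((\<lambda>\<epsilon>. (g x + \<epsilon> * h x) - (g u + \<epsilon> * h u)) \<longlongrightarrow> (g x + 0 * h x) - (g u + 0 * h u)) (at_right 0)"
      by (intro tendsto_intros)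
    ultimately have "\<forall>\<^sub>F \<epsilon> in at_right 0. (g x + \<epsilon> * h x) - (g u + \<epsilon> * h u) > 0"
      by (intro order_tendstoD(1)) auto
    then show ?thesis by eventually_elim simp
  qed
  then have "\<forall>\<^sub>F \<epsilon> in at_right 0. \<forall>u\<in>S. \<forall>x\<in>A-S. g u + \<epsilon> * h u < g x + \<epsilon> * h x"
    using fS A by (intro eventually_ball_finite ballI) auto
  moreover have "\<forall>\<^sub>F \<epsilon>::real in at_right 0. \<epsilon> > 0" by (simp add: eventually_at_right_less)
  ultimately show ?thesis
  proof eventually_elim
    case (elim \<epsilon>)
    have SA: "S \<subseteq> A" using S by auto
    have geq: "g u = g x" if "u \<in> S" "x \<in> S" for u x using that S by (auto intro: antisym)
    have inS: "u \<in> S" if u: "u \<in> A" "\<forall>x\<in>A. g u + \<epsilon> * h u \<le> g x + \<epsilon> * h x" for u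
    proof (rule ccontr)
      assume "u \<notin> S"
      obtain x where x: "x \<in> A" "\<forall>y\<in>A. g x \<le> g y"
        using A u(1) ex_min_if_finite[of "g ` A"] by (force simp: not_less)
      then have "x \<in> S" using S by auto
      then have "g x + \<epsilon> * h x < g u + \<epsilon> * h u" using elim(1) u(1) \<open>u \<notin> S\<close> by blast
      then show False using u(2) x(1) by (meson not_less)
    qed
    show ?case
      unfolding min_attained_twice_iff[OF A] min_attained_twice_iff[OF fS]
    proof safe
      fix u u' assume u: "u \<in> A" "u' \<in> A" "u \<noteq> u'" "g u + \<epsilon> * h u = g u' + \<epsilon> * h u'"
        "\<forall>x\<in>A. g u + \<epsilon> * h u \<le> g x + \<epsilon> * h x"
      then have uS: "u \<in> S" "u' \<in> S" using inS by auto
      have "h u \<le> h x" if "x \<in> S" for x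
      proof -
        have "g u + \<epsilon> * h u \<le> g x + \<epsilon> * h x" using u(5) that SA by blast
        then have "\<epsilon> * h u \<le> \<epsilon> * h x" using geq[OF uS(1) that] by simp
        then show ?thesis using elim(2) by simp
      qed
      moreover have "h u = h u'" using u(4) geq[OF uS] elim(2) by simp
      ultimately show "\<exists>u\<in>S. \<exists>u'\<in>S. u \<noteq> u' \<and> h u = h u' \<and> (\<forall>x\<in>S. h u \<le> h x)"
        using uS u(3) by blast
    next
      fix u u' assume u: "u \<in> S" "u' \<in> S" "u \<noteq> u'" "h u = h u'" "\<forall>x\<in>S. h u \<le> h x"
      have "g u + \<epsilon> * h u \<le> g x + \<epsilon> * h x" if "x \<in> A" for x
      proof (cases "x \<in> S")
        case True
        then have "g u = g x" "\<epsilon> * h u \<le> \<epsilon> * h x" using geq[OF u(1) True] u(5) elim(2) by simp_all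
        then show ?thesis by simp
      next
        case False
        then show ?thesis using elim(1) u(1) that by (meson DiffI less_imp_le)
      qed
      moreover have "g u + \<epsilon> * h u = g u' + \<epsilon> * h u'" using geq[OF u(1,2)] u(4) by simp
      ultimately show "\<exists>u\<in>A. \<exists>u'\<in>A. u \<noteq> u' \<and> g u + \<epsilon> * h u = g u' + \<epsilon> * h u' \<and>
            (\<forall>x\<in>A. g u + \<epsilon> * h u \<le> g x + \<epsilon> * h x)"
        using u SA by blast
    qed
  qed
qed

section \<open>Reconstructing a simplex from its normal fan\<close>

text \<open>If the tropical hypersurface of the linear forms \<open>\<lambda> _ u\<close>, \<open>u \<in> B\<close>, is the
  standard tropical hyperplane, then the Newton polytope of \<open>B\<close> is a translated dilated
  standard simplex. The minimizer at \<open>- e\<^sub>m\<close> stays the unique minimizer in the direction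
  \<open>e\<^sub>n\<close>, \<open>n \<noteq> m\<close>, since a change would produce a tie.\<close>

lemma simplex_of_tropical_hyperplane:
  fixes lam :: "'n::finite \<Rightarrow> 'b \<Rightarrow> real"
  assumes B: "finite B" and inj: "\<And>u u'. \<lbrakk>u \<in> B; u' \<in> B; \<And>n. lam n u = lam n u'\<rbrakk> \<Longrightarrow> u = u'"
    and two: "CARD('n) \<ge> 2"
    and sum1: "\<And>u. u \<in> B \<Longrightarrow> (\<Sum>n\<in>UNIV. lam n u) = 1"
    and same: "\<And>c. min_attained_twice UNIV c \<longleftrightarrow>
       min_attained_twice B (\<lambda>u. \<Sum>n\<in>UNIV. c n * lam n u)"
  obtains t r where "r > 0" "r = 1 - (\<Sum>n\<in>UNIV. t n)"
    "\<And>n u. u \<in> B \<Longrightarrow> t n \<le> lam n u"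
    "\<And>m. \<exists>u\<in>B. \<forall>n. lam n u = t n + (if n = m then r else 0)"
proof -
  define val where "val c u = (\<Sum>n\<in>UNIV. c n * lam n u)" for c u
  have val_add: "val (\<lambda>n. c n + (if n = k then s else 0)) u = val c u + s * lam k u" for c k s u
    unfolding val_def distrib_right sum.distrib by (simp add: if_distrib if_distribR cong: if_cong)
  obtain m0 m1 :: 'n where m01: "m0 \<noteq> m1"
    using two card_le_Suc0_iff_eq[of "UNIV :: 'n set"] by fastforce
  have "min_attained_twice (UNIV :: 'n set) (\<lambda>_. 0)"
    unfolding min_attained_twice_iff[OF finite] using m01 by auto
  then obtain u0 u1 where u01: "u0 \<in> B" "u1 \<in> B" "u0 \<noteq> u1"
    unfolding same min_attained_twice_iff[OF B] by blast
  have key: "\<exists>u\<in>B. \<forall>n. n \<noteq> m \<longrightarrow> (\<forall>x\<in>B. lam n u \<le> lam n x)" for m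
  proof -
    define c where "c n = (if n = m then - 1 else 0::real)" for n
    obtain u where u: "u \<in> B" "\<forall>x\<in>B. val c u \<le> val c x"
      using B u01(1) ex_min_if_finite[of "val c ` B"] by (force simp: not_less)
    \<comment> \<open>A point whose \<open>m\<close>-th coordinate is strictly smallest lies off the
      standard tropical hyperplane, hence \<open>B\<close> has no tie for the minimum there.\<close>
    have untied: False
      if d: "\<forall>n. n \<noteq> m \<longrightarrow> d m < d n" and "y \<in> B" "y \<noteq> u" "val d u = val d y" "\<forall>x\<in>B. val d u \<le> val d x" for d y
    proof -
      have "min_attained_twice B (val d)" unfolding min_attained_twice_iff[OF B]
        using that u(1) by (intro bexI[of _ u] bexI[of _ y]) auto
      then have "min_attained_twice UNIV d" using same[of d] by (simp add: val_def[abs_def])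
      then obtain k k' where "k \<noteq> k'" "d k = d k'" "\<forall>x. d k \<le> d x"
        unfolding min_attained_twice_iff[OF finite] by blast
      then show False using d by (metis not_less)
    qed
    have strict: "val c u < val c x" if "x \<in> B" "x \<noteq> u" for x
      using untied[of c x] u that by (force simp: c_def less_le)
    have "lam n u \<le> lam n x" if nm: "n \<noteq> m" and x: "x \<in> B" for n x
    proof (rule ccontr)
      assume "\<not> lam n u \<le> lam n x"
      define Y where "Y = {y\<in>B. lam n y < lam n u}"
      \<comment> \<open>Moving from \<open>c\<close> in direction \<open>n\<close>, the point
        \<open>y\<close> overtakes \<open>u\<close> at parameter \<open>q y\<close>. At the smallest
        such parameter nothing lies below \<open>u\<close> yet, so \<open>u\<close> and
        \<open>y\<close> tie for the minimum, which \<open>untied\<close> forbids.\<close>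
      define q where "q y = (val c y - val c u) / (lam n u - lam n y)" for y
      have Y: "finite Y" "Y \<noteq> {}" using B x \<open>\<not> lam n u \<le> lam n x\<close> unfolding Y_def by auto
      then obtain y where y: "y \<in> Y" "\<forall>z\<in>Y. q y \<le> q z"
        using ex_min_if_finite[of "q ` Y"] by (force simp: not_less)
      define d where "d = (\<lambda>k. c k + (if k = n then q y else 0))"
      have yB: "y \<in> B" "lam n y < lam n u" "y \<noteq> u" using y(1) unfolding Y_def by auto
      have q0: "q y > 0" using strict[of y] yB by (simp add: q_def)
      have vd: "val d w = val c w + q y * lam n w" for w unfolding d_def by (rule val_add)
      have "val d u = val d y" using yB unfolding vd q_def by (simp add: field_simps)
      moreover have "val d u \<le> val d z" if "z \<in> B" for z
      proof (cases "z \<in> Y")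
        case True
        then have "q y \<le> q z" "lam n u - lam n z > 0" using y unfolding Y_def by auto
        then have "q y * (lam n u - lam n z) \<le> val c z - val c u" unfolding q_def[of z]
          by (simp add: pos_le_divide_eq)
        then show ?thesis unfolding vd by (simp add: algebra_simps)
      next
        case False
        then have "lam n u \<le> lam n z" using that unfolding Y_def by auto
        then have "q y * lam n u \<le> q y * lam n z" using q0 by simp
        then show ?thesis unfolding vd using u that by force
      qed
      moreover have "\<forall>k. k \<noteq> m \<longrightarrow> d m < d k" using q0 nm by (simp add: d_def c_def)
      ultimately show False using untied[of d y] yB by simp
    qed
    then show ?thesis using u by blast
  qed
  \<comment> \<open>The corner for \<open>m\<close> minimizes every other coordinate; since
    coordinates sum to 1, its \<open>m\<close>-th one must exceed \<open>t m\<close> by exactly the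
    total slack \<open>r\<close>.\<close>
  define t where "t n = Min (lam n ` B)" for n
  define r where "r = 1 - (\<Sum>n\<in>UNIV. t n)"
  have tle: "t n \<le> lam n u" if "u \<in> B" for n u using B that unfolding t_def by simp
  have corner: "\<exists>u\<in>B. \<forall>n. lam n u = t n + (if n = m then r else 0)" for m
  proof -
    obtain u where u: "u \<in> B" "\<forall>n. n \<noteq> m \<longrightarrow> (\<forall>x\<in>B. lam n u \<le> lam n x)" using key by blast
    have eq: "lam n u = t n" if "n \<noteq> m" for n
      unfolding t_def using u that B by (intro Min_eqI[symmetric]) auto
    have "(\<Sum>n\<in>UNIV. lam n u) = lam m u + (\<Sum>n\<in>UNIV - {m}. t n)"
      using eq by (simp add: sum.remove[of UNIV m])
    moreover have "(\<Sum>n\<in>UNIV. t n) = t m + (\<Sum>n\<in>UNIV - {m}. t n)" by (simp add: sum.remove[of UNIV m])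
    ultimately have "lam m u = t m + r" using sum1[OF u(1)] unfolding r_def by simp
    then show ?thesis using u(1) eq by (intro bexI[of _ u]) auto
  qed
  \<comment> \<open>Without positive slack every coordinate would equal its minimum and
    \<open>B\<close> would collapse to one point, against \<open>u0\<close> and
    \<open>u1\<close>.\<close>
  have "r > 0"
  proof (rule ccontr)
    assume "\<not> r > 0"
    have "lam n u = t n" if "u \<in> B" for n u
    proof -
      have "(\<Sum>n\<in>UNIV. lam n u - t n) \<le> 0"
        using sum1[OF that] \<open>\<not> r > 0\<close> unfolding r_def sum_subtractf by simp
      moreover have "lam n u - t n \<le> (\<Sum>n\<in>UNIV. lam n u - t n)"
        using tle[OF that] by (intro member_le_sum) auto
      ultimately show ?thesis using tle[OF that, of n] by linarith
    qed
    then show False using inj[of u0 u1] u01 by simp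
  qed
  then show ?thesis using that r_def tle corner by blast
qed

section \<open>Unimodular tetrahedra determined by their fan\<close>

text \<open>\<open>W\<close> is the basis dual to the vertices, so \<open>pairing u (W n)\<close> is
  the \<open>n\<close>-th barycentric coordinate of a cubic exponent \<open>u\<close>. Unimodularity
  is encoded as integrality of these coordinates. \<open>meets_facets\<close> says that the four
  monomials have no common variable.\<close>

locale unimodular_frame =
  fixes s :: "4 \<Rightarrow> nat^4" and W :: "4 \<Rightarrow> real^4"
  assumes degree_vertex: "\<And>n. (\<Sum>i\<in>UNIV. s n $ i) = 3"
    and dual: "\<And>m n. pairing (s m) (W n) = (if m = n then 1 else 0)"
    and coordinate_int: "\<And>u n. (\<Sum>i\<in>UNIV. u $ i) = 3 \<Longrightarrow> pairing u (W n) \<in> \<int>"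
    and sum_coordinates: "\<And>u. (\<Sum>i\<in>UNIV. u $ i) = 3 \<Longrightarrow> (\<Sum>n\<in>UNIV. pairing u (W n)) = 1"
    and expand: "\<And>u i. (\<Sum>i\<in>UNIV. u $ i) = 3 \<Longrightarrow>
       real (u $ i) = (\<Sum>n\<in>UNIV. pairing u (W n) * real (s n $ i))"
    and meets_facets: "\<And>i. \<exists>n. s n $ i = 0"
begin

lemma inj_vertex: "inj s"
proof (rule injI)
  fix m n assume "s m = s n"
  then have "pairing (s m) (W n) = pairing (s n) (W n)" by simp
  then show "m = n" unfolding dual by (auto split: if_splits)
qed

lemma pairing_sum: "pairing u (\<Sum>n\<in>UNIV. c n *\<^sub>R W n) = (\<Sum>n\<in>UNIV. c n * pairing u (W n))"
proof -
  have "pairing u (\<Sum>n\<in>UNIV. c n *\<^sub>R W n) =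
      (\<Sum>i\<in>UNIV. \<Sum>n\<in>UNIV. c n * (real (u $ i) * W n $ i))"
    unfolding pairing_def by (simp add: sum_distrib_left mult_ac)
  also have "\<dots> = (\<Sum>n\<in>UNIV. c n * pairing u (W n))"
    unfolding pairing_def by (subst sum.swap) (simp add: sum_distrib_left)
  finally show ?thesis .
qed

lemma coordinates_determine:
  assumes "(\<Sum>i\<in>UNIV. u $ i) = 3" "(\<Sum>i\<in>UNIV. u' $ i) = 3"
    and "\<And>n. pairing u (W n) = pairing u' (W n)"
  shows "u = u'"
proof (rule vec_eq_iff[THEN iffD2], rule allI)
  fix i
  have "real (u $ i) = real (u' $ i)"
    unfolding expand[OF assms(1)] expand[OF assms(2)] assms(3) ..
  then show "u $ i = u' $ i" by simp
qed

text \<open>In the coordinates dual to \<open>s\<close> the fan is the standard tropical hyperplane,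
  so the corners of \<open>B\<close> are \<open>T + r * s m\<close>. Nonnegativity of
  \<open>T\<close> and the degree give r \<le> 1, integrality gives r \<ge> 1.\<close>

lemma same_tropical_fan_imp_eq:
  assumes B: "finite B" "\<And>u. u \<in> B \<Longrightarrow> (\<Sum>i\<in>UNIV. u $ i) = 3"
    and fan: "\<And>w. min_attained_twice (range s) (\<lambda>u. pairing u w) \<longleftrightarrow>
       min_attained_twice B (\<lambda>u. pairing u w)"
  shows "B = range s"
proof -
  have same: "min_attained_twice UNIV c \<longleftrightarrow>
      min_attained_twice B (\<lambda>u. \<Sum>n\<in>UNIV. c n * pairing u (W n))" for c
  proof -
    have "(\<lambda>n. pairing (s n) (\<Sum>n\<in>UNIV. c n *\<^sub>R W n)) = c"
      unfolding pairing_sum dual by (simp add: fun_eq_iff if_distrib cong: if_cong)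
    then show ?thesis
      using fan[of "\<Sum>n\<in>UNIV. c n *\<^sub>R W n"]
      unfolding min_attained_twice_image[OF finite inj_vertex] pairing_sum by simp
  qed
  obtain t r where tr: "r > 0" "r = 1 - (\<Sum>n\<in>UNIV. t n)"
    "\<And>n u. u \<in> B \<Longrightarrow> t n \<le> pairing u (W n)"
    "\<And>m. \<exists>u\<in>B. \<forall>n. pairing u (W n) = t n + (if n = m then r else 0)"
  proof (rule simplex_of_tropical_hyperplane[of B "\<lambda>n u. pairing u (W n)"])
    show "u = u'" if "u \<in> B" "u' \<in> B" "\<And>n. pairing u (W n) = pairing u' (W n)" for u u'
      using coordinates_determine that B(2) by blast
  qed (use B same sum_coordinates in auto)
  \<comment> \<open>The translation \<open>t\<close>, carried from barycentric coordinates back to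
    exponents.\<close>
  define T where "T i = (\<Sum>n\<in>UNIV. t n * real (s n $ i))" for i
  have u_eq: "\<exists>u\<in>B. (\<forall>n. pairing u (W n) = t n + (if n = m then r else 0)) \<and>
      (\<forall>i. real (u $ i) = T i + r * real (s m $ i))" for m
  proof -
    obtain u where u: "u \<in> B" "\<forall>n. pairing u (W n) = t n + (if n = m then r else 0)"
      using tr(4) by blast
    have "real (u $ i) = T i + r * real (s m $ i)" for i
      unfolding expand[OF B(2)[OF u(1)]] T_def u(2)[rule_format] distrib_right sum.distrib
      by (simp add: if_distrib if_distribR cong: if_cong)
    then show ?thesis using u by blast
  qed
  \<comment> \<open>At a vertex whose \<open>i\<close>-th exponent is zero, the dilated part
    contributes nothing, so \<open>T i\<close> is itself an exponent of an element of
    \<open>B\<close>.\<close>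
  have T0: "T i \<ge> 0" for i
  proof -
    obtain m where "s m $ i = 0" using meets_facets by blast
    then show ?thesis using u_eq[of m] by (metis add.right_neutral mult_zero_right of_nat_0 of_nat_0_le_iff)
  qed
  have sumT: "(\<Sum>i\<in>UNIV. T i) = 3 * (1 - r)"
  proof -
    have "(\<Sum>i\<in>UNIV. T i) = (\<Sum>n\<in>UNIV. t n * real (\<Sum>i\<in>UNIV. s n $ i))"
      unfolding T_def by (subst sum.swap) (simp add: sum_distrib_left)
    then show ?thesis unfolding degree_vertex tr(2) by (simp add: sum_distrib_right[symmetric])
  qed
  \<comment> \<open>Any corner other than the \<open>n\<close>-th has \<open>n\<close>-th coordinate
    exactly \<open>t n\<close>, and barycentric coordinates of monomials are integers.\<close>
  have int_t: "t n \<in> \<int>" for n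
  proof -
    obtain m where "m \<noteq> n" by (metis (full_types) zero_neq_one)
    then obtain u where "u \<in> B" "pairing u (W n) = t n" using tr(4)[of m] by fastforce
    then show ?thesis using coordinate_int B(2) by metis
  qed
  have "r \<in> \<int>" unfolding tr(2) using int_t by (intro Ints_diff Ints_1 Ints_sum) auto
  then have "r \<ge> 1" using tr(1) by (auto elim!: Ints_cases)
  moreover have "r \<le> 1" using sumT sum_nonneg[of UNIV T] T0 by simp
  ultimately have r: "r = 1" by simp
  have T: "T i = 0" for i
    using sumT T0 r by (simp add: sum_nonneg_eq_0_iff)
  have corner: "s m \<in> B \<and> (\<forall>n. pairing (s m) (W n) = t n + (if n = m then r else 0))" for m
  proof -
    obtain u where u: "u \<in> B" "\<forall>n. pairing u (W n) = t n + (if n = m then r else 0)"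
      "\<forall>i. real (u $ i) = real (s m $ i)"
      using u_eq[of m] r T by auto
    then have "u = s m" by (simp add: vec_eq_iff)
    then show ?thesis using u(1,2) by simp
  qed
  have t: "t n = 0" for n
    using conjunct2[OF corner[of n], rule_format, of n] r by (simp add: dual)
  \<comment> \<open>Nonnegative integers with sum 1 form a unit vector: a unimodular simplex
    contains no lattice points besides its vertices.\<close>
  have "u \<in> range s" if u: "u \<in> B" for u
  proof -
    have nn: "pairing u (W n) \<ge> 0" for n using tr(3)[OF u] t by simp
    have "\<exists>m. pairing u (W m) \<noteq> 0"
      using sum_coordinates[OF B(2)[OF u]] by (metis sum.neutral zero_neq_one)
    then obtain m where "pairing u (W m) \<noteq> 0" by blast
    then have m: "pairing u (W m) \<ge> 1"
      using nn[of m] coordinate_int[OF B(2)[OF u], of m] by (auto elim!: Ints_cases)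
    have S: "pairing u (W m) + (\<Sum>n\<in>UNIV - {m}. pairing u (W n)) = 1"
      using sum_coordinates[OF B(2)[OF u]] by (simp add: sum.remove[of UNIV m])
    have "(\<Sum>n\<in>UNIV - {m}. pairing u (W n)) \<ge> 0" by (intro sum_nonneg nn)
    then have e: "pairing u (W m) = 1" "(\<Sum>n\<in>UNIV - {m}. pairing u (W n)) = 0" using S m by auto
    then have "pairing u (W n) = pairing (s m) (W n)" for n
      using nn by (auto simp: dual sum_nonneg_eq_0_iff)
    then have "u = s m" using coordinates_determine[OF B(2)[OF u] degree_vertex] by blast
    then show ?thesis by simp
  qed
  then show ?thesis using corner by auto
qed

end

section \<open>The two explicit tetrahedra as unimodular frames\<close>

lemma UNIV_4: "(UNIV :: 4 set) = {0, 1, 2, 3}"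
proof -
  have "x = 0 \<or> x = 1 \<or> x = 2 \<or> x = 3" for x :: 4
    using exhaust_4[of x] by auto
  then show ?thesis by auto
qed

lemma sum_UNIV_4: "(\<Sum>i\<in>UNIV. g i) = g 0 + g 1 + g 2 + g (3::4)"
  unfolding UNIV_4 by (simp add: add.assoc)

lemma all_4_iff: "(\<forall>i. P i) \<longleftrightarrow> P 0 \<and> P 1 \<and> P 2 \<and> P (3::4)"
  using UNIV_4 by (metis UNIV_I empty_iff insert_iff)

lemma exponent_vector_nth [simp]:
  "exponent_vector a b c d $ 0 = a" "exponent_vector a b c d $ 1 = b"
  "exponent_vector a b c d $ 2 = c" "exponent_vector a b c d $ 3 = d"
  by (simp_all add: exponent_vector_def)

definition vertex_3I_1 :: "4 \<Rightarrow> nat^4" where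
  "vertex_3I_1 n = (if n = 0 then exponent_vector 3 0 0 0 else if n = 1 then exponent_vector 2 0 0 1
     else if n = 2 then exponent_vector 0 2 1 0 else exponent_vector 0 1 0 2)"

definition vertex_3I_2 :: "4 \<Rightarrow> nat^4" where
  "vertex_3I_2 n = (if n = 0 then exponent_vector 3 0 0 0 else if n = 1 then exponent_vector 2 0 0 1
     else if n = 2 then exponent_vector 0 2 1 0 else exponent_vector 0 1 1 1)"

lemma range_vertex_3I: "range vertex_3I_1 = tetrahedron_3I_1" "range vertex_3I_2 = tetrahedron_3I_2"
  unfolding UNIV_4 tetrahedron_3I_1_def tetrahedron_3I_2_def
  by (auto simp: vertex_3I_1_def vertex_3I_2_def)

definition real_vector4 :: "real \<Rightarrow> real \<Rightarrow> real \<Rightarrow> real \<Rightarrow> real^4" where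
  "real_vector4 a b c d = (\<chi> i. if i = 0 then a else if i = 1 then b else if i = 2 then c else d)"

lemma pairing_real_vector4:
  "pairing u (real_vector4 a b c d) =
     real (u $ 0) * a + real (u $ 1) * b + real (u $ 2) * c + real (u $ 3) * d"
  unfolding pairing_def sum_UNIV_4 by (simp add: real_vector4_def)

text \<open>The rows of the inverse of the matrix of the four exponent vectors. The fractions
  come from writing the constant \<open>1\<close> as a third of the degree.\<close>

definition covertex_3I_1 :: "4 \<Rightarrow> real^4" where
  "covertex_3I_1 n = (if n = 0 then real_vector4 (1/3) (4/3) (-8/3) (-2/3)
     else if n = 1 then real_vector4 0 (-2) 4 1
     else if n = 2 then real_vector4 0 0 1 0 else real_vector4 0 1 (-2) 0)"

definition covertex_3I_2 :: "4 \<Rightarrow> real^4" where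
  "covertex_3I_2 n = (if n = 0 then real_vector4 (1/3) (-2/3) (4/3) (-2/3)
     else if n = 1 then real_vector4 0 1 (-2) 1
     else if n = 2 then real_vector4 0 1 (-1) 0 else real_vector4 0 (-1) 2 0)"

lemma frame_3I_1: "unimodular_frame vertex_3I_1 covertex_3I_1"
proof
  fix u :: "nat^4" and n :: 4
  assume "(\<Sum>i\<in>UNIV. u $ i) = 3"
  then have u: "real (u $ 0) = 3 - real (u $ 1) - real (u $ 2) - real (u $ 3)"
    unfolding sum_UNIV_4 by linarith
  have "pairing u (covertex_3I_1 0) = of_int (1 + int (u $ 1) - 3 * int (u $ 2) - int (u $ 3))"
    "pairing u (covertex_3I_1 1) = of_int (- 2 * int (u $ 1) + 4 * int (u $ 2) + int (u $ 3))"
    "pairing u (covertex_3I_1 2) = of_int (int (u $ 2))"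
    "pairing u (covertex_3I_1 3) = of_int (int (u $ 1) - 2 * int (u $ 2))"
    by (simp_all add: covertex_3I_1_def pairing_real_vector4 u field_simps)
  then have "\<forall>n. pairing u (covertex_3I_1 n) \<in> \<int>" unfolding all_4_iff by (metis Ints_of_int)
  then show "pairing u (covertex_3I_1 n) \<in> \<int>" ..
  show "(\<Sum>n\<in>UNIV. pairing u (covertex_3I_1 n)) = 1"
    unfolding sum_UNIV_4 by (simp add: covertex_3I_1_def pairing_real_vector4 u field_simps)
next
  fix u :: "nat^4" and i :: 4
  have "\<forall>i. real (u $ i) = (\<Sum>n\<in>UNIV. pairing u (covertex_3I_1 n) * real (vertex_3I_1 n $ i))"
    unfolding sum_UNIV_4 all_4_iff
    by (simp add: covertex_3I_1_def vertex_3I_1_def pairing_real_vector4 algebra_simps)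
  then show "real (u $ i) = (\<Sum>n\<in>UNIV. pairing u (covertex_3I_1 n) * real (vertex_3I_1 n $ i))" ..
next
  fix n
  have "\<forall>n. (\<Sum>i\<in>UNIV. vertex_3I_1 n $ i) = 3"
    unfolding sum_UNIV_4 by (simp add: vertex_3I_1_def)
  then show "(\<Sum>i\<in>UNIV. vertex_3I_1 n $ i) = 3" ..
next
  fix m n
  have "\<forall>m n. pairing (vertex_3I_1 m) (covertex_3I_1 n) = (if m = n then 1 else 0)"
    unfolding all_4_iff by (simp add: vertex_3I_1_def covertex_3I_1_def pairing_real_vector4)
  then show "pairing (vertex_3I_1 m) (covertex_3I_1 n) = (if m = n then 1 else 0)" by blast
next
  fix i
  have "vertex_3I_1 2 $ 0 = 0" "vertex_3I_1 0 $ 1 = 0" "vertex_3I_1 0 $ 2 = 0" "vertex_3I_1 0 $ 3 = 0"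
    by (simp_all add: vertex_3I_1_def)
  then have "\<forall>i. \<exists>n. vertex_3I_1 n $ i = 0" unfolding all_4_iff by blast
  then show "\<exists>n. vertex_3I_1 n $ i = 0" ..
qed

lemma frame_3I_2: "unimodular_frame vertex_3I_2 covertex_3I_2"
proof
  fix u :: "nat^4" and n :: 4
  assume "(\<Sum>i\<in>UNIV. u $ i) = 3"
  then have u: "real (u $ 0) = 3 - real (u $ 1) - real (u $ 2) - real (u $ 3)"
    unfolding sum_UNIV_4 by linarith
  have "pairing u (covertex_3I_2 0) = of_int (1 - int (u $ 1) + int (u $ 2) - int (u $ 3))"
    "pairing u (covertex_3I_2 1) = of_int (int (u $ 1) - 2 * int (u $ 2) + int (u $ 3))"
    "pairing u (covertex_3I_2 2) = of_int (int (u $ 1) - int (u $ 2))"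
    "pairing u (covertex_3I_2 3) = of_int (- int (u $ 1) + 2 * int (u $ 2))"
    by (simp_all add: covertex_3I_2_def pairing_real_vector4 u field_simps)
  then have "\<forall>n. pairing u (covertex_3I_2 n) \<in> \<int>" unfolding all_4_iff by (metis Ints_of_int)
  then show "pairing u (covertex_3I_2 n) \<in> \<int>" ..
  show "(\<Sum>n\<in>UNIV. pairing u (covertex_3I_2 n)) = 1"
    unfolding sum_UNIV_4 by (simp add: covertex_3I_2_def pairing_real_vector4 u field_simps)
next
  fix u :: "nat^4" and i :: 4
  have "\<forall>i. real (u $ i) = (\<Sum>n\<in>UNIV. pairing u (covertex_3I_2 n) * real (vertex_3I_2 n $ i))"
    unfolding sum_UNIV_4 all_4_iff
    by (simp add: covertex_3I_2_def vertex_3I_2_def pairing_real_vector4 algebra_simps)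
  then show "real (u $ i) = (\<Sum>n\<in>UNIV. pairing u (covertex_3I_2 n) * real (vertex_3I_2 n $ i))" ..
next
  fix n
  have "\<forall>n. (\<Sum>i\<in>UNIV. vertex_3I_2 n $ i) = 3"
    unfolding sum_UNIV_4 by (simp add: vertex_3I_2_def)
  then show "(\<Sum>i\<in>UNIV. vertex_3I_2 n $ i) = 3" ..
next
  fix m n
  have "\<forall>m n. pairing (vertex_3I_2 m) (covertex_3I_2 n) = (if m = n then 1 else 0)"
    unfolding all_4_iff by (simp add: vertex_3I_2_def covertex_3I_2_def pairing_real_vector4)
  then show "pairing (vertex_3I_2 m) (covertex_3I_2 n) = (if m = n then 1 else 0)" by blast
next
  fix i
  have "vertex_3I_2 2 $ 0 = 0" "vertex_3I_2 0 $ 1 = 0" "vertex_3I_2 0 $ 2 = 0" "vertex_3I_2 0 $ 3 = 0"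
    by (simp_all add: vertex_3I_2_def)
  then have "\<forall>i. \<exists>n. vertex_3I_2 n $ i = 0" unfolding all_4_iff by blast
  then show "\<exists>n. vertex_3I_2 n $ i = 0" ..
qed

lemma permute_coordinates_nth [simp]: "permute_coordinates \<pi> u $ i = u $ \<pi> i"
  by (simp add: permute_coordinates_def)

text \<open>The types are defined up to permuting coordinates, so the explicit frames have to be
  transported. Permuting the covector amounts to the inverse permutation of the exponent, which
  preserves the degree.\<close>

lemma unimodular_frame_permute:
  assumes "unimodular_frame s W" and \<pi>: "bij \<pi>"
  shows "unimodular_frame (\<lambda>n. permute_coordinates \<pi> (s n)) (\<lambda>n. \<chi> i. W n $ \<pi> i)"
proof -
  interpret unimodular_frame s W by fact
  have re: "(\<Sum>i\<in>UNIV. g (\<pi> i)) = (\<Sum>i\<in>UNIV. g i)" for g :: "4 \<Rightarrow> 'b::comm_monoid_add"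
    by (rule sum.reindex_bij_betw[OF \<pi>])
  define \<sigma> where "\<sigma> = inv_into UNIV \<pi>"
  have \<sigma>: "bij \<sigma>" unfolding \<sigma>_def using \<pi> by (rule bij_imp_bij_inv)
  have inv: "\<sigma> (\<pi> i) = i" for i unfolding \<sigma>_def using \<pi> by (simp add: bij_is_inj)
  have pair: "pairing u (\<chi> i. W n $ \<pi> i) = pairing (permute_coordinates \<sigma> u) (W n)" for u n
    unfolding pairing_def using re[of "\<lambda>i. real (u $ \<sigma> i) * W n $ i"] by (simp add: inv)
  have undo: "permute_coordinates \<sigma> (permute_coordinates \<pi> u) = u" for u
    using \<pi> by (simp add: vec_eq_iff \<sigma>_def bij_is_surj surj_f_inv_f)
  have deg: "(\<Sum>i\<in>UNIV. permute_coordinates \<sigma> u $ i) = (\<Sum>i\<in>UNIV. u $ i)" for u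
    using sum.reindex_bij_betw[OF \<sigma>, of "\<lambda>i. u $ i"] by simp
  show ?thesis
  proof
    show "(\<Sum>i\<in>UNIV. permute_coordinates \<pi> (s n) $ i) = 3" for n
      using re[of "\<lambda>i. s n $ i"] degree_vertex by simp
    show "pairing (permute_coordinates \<pi> (s m)) (\<chi> i. W n $ \<pi> i) = (if m = n then 1 else 0)" for m n
      unfolding pair undo by (rule dual)
    show "\<exists>n. permute_coordinates \<pi> (s n) $ i = 0" for i using meets_facets by simp
  next
    fix u :: "nat^4"
    assume u: "(\<Sum>i\<in>UNIV. u $ i) = 3"
    then have u': "(\<Sum>i\<in>UNIV. permute_coordinates \<sigma> u $ i) = 3" unfolding deg .
    show "pairing u (\<chi> i. W n $ \<pi> i) \<in> \<int>" for n
      unfolding pair using coordinate_int[OF u'] .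
    show "(\<Sum>n\<in>UNIV. pairing u (\<chi> i. W n $ \<pi> i)) = 1"
      unfolding pair using sum_coordinates[OF u'] .
    show "real (u $ i) = (\<Sum>n\<in>UNIV. pairing u (\<chi> i. W n $ \<pi> i) * real (permute_coordinates \<pi> (s n) $ i))" for i
      unfolding pair using expand[OF u', of "\<pi> i"] by (simp add: inv)
  qed
qed

section \<open>Facets and vertices of lattice polytopes\<close>

lemma lattice_point_inj:
  assumes "(\<Sum>i\<in>UNIV. u $ i) = 3" "(\<Sum>i\<in>UNIV. u' $ i) = 3" "lattice_point u = lattice_point u'"
  shows "u = u'"
proof -
  have "real (u $ 1) = real (u' $ 1) \<and> real (u $ 2) = real (u' $ 2) \<and> real (u $ 3) = real (u' $ 3)"
    using assms(3) unfolding lattice_point_def by (metis vector_3)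
  then have "u $ 1 = u' $ 1 \<and> u $ 2 = u' $ 2 \<and> u $ 3 = u' $ 3" by simp
  moreover have "u $ 0 = u' $ 0" using assms(1,2) calculation unfolding sum_UNIV_4 by linarith
  ultimately show ?thesis unfolding vec_eq_iff all_4_iff by blast
qed

lemma lattice_point_in_facet_imp:
  assumes u: "(\<Sum>m\<in>UNIV. u $ m) = 3" and "lattice_point u \<in> facet i"
  shows "u $ i = 0"
proof -
  \<comment> \<open>The supporting hyperplane of the facet. Since \<open>lattice_point\<close> drops
    the coordinate 0, the condition \<open>w $ 0 = 0\<close> reads as the other three exponents
    summing to 3.\<close>
  define d :: "real^3" where "d = (if i = 0 then vector [1,1,1] else if i = 1 then vector [1,0,0]
    else if i = 2 then vector [0,1,0] else vector [0,0,1])"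
  define b :: real where "b = (if i = 0 then 3 else 0)"
  have iff: "d \<bullet> lattice_point w = b \<longleftrightarrow> w $ i = 0" if w: "(\<Sum>m\<in>UNIV. w $ m) = 3" for w
  proof -
    have "\<forall>i. (if i = 0 then vector [1,1,1] else if i = 1 then vector [1,0,0]
      else if i = 2 then vector [0,1,0] else vector [0,0,1] :: real^3) \<bullet> lattice_point w = (if i = 0 then 3 else 0)
       \<longleftrightarrow> w $ i = 0"
      using w unfolding all_4_iff sum_UNIV_4
      by (simp add: inner_vec_def sum_3 lattice_point_def) linarith
    then show ?thesis unfolding d_def b_def by blast
  qed
  have "facet i \<subseteq> {x. d \<bullet> x = b}"
    unfolding facet_def lattice_polytope_def
    using iff by (intro hull_minimal convex_hyperplane) auto
  then show ?thesis using iff[OF u] assms(2) by auto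
qed

text \<open>A tetrahedron of positive volume has affinely independent vertices, so they are extreme
  points of its hull and occur in every generating set.\<close>

lemma unimodular_eq_of_lattice_polytope_eq:
  assumes A: "unimodular_tetrahedron A" and deg: "\<And>u. u \<in> A \<union> B \<Longrightarrow> (\<Sum>i\<in>UNIV. u $ i) = 3"
    and B: "finite B" "card B \<le> 4" and eq: "lattice_polytope A = lattice_polytope B"
  shows "A = B"
proof -
  have inj: "inj_on lattice_point (A \<union> B)" using deg by (auto intro!: inj_onI lattice_point_inj)
  have cA: "card A = 4" "measure lebesgue (lattice_polytope A) = 1 / 6"
    using A unfolding unimodular_tetrahedron_def by auto
  then have fA: "finite A" by (metis card.infinite zero_neq_numeral)
  have card: "card (lattice_point ` A) = 4"
    using inj cA card_image[of lattice_point A] by (metis inj_on_Un)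
  have indep: "\<not> affine_dependent (lattice_point ` A)"
  proof
    assume "affine_dependent (lattice_point ` A)"
    then have "aff_dim (lattice_point ` A) < 3"
      using card affine_independent_iff_card[of "lattice_point ` A"]
        aff_dim_le_card[of "lattice_point ` A"] fA by auto
    then have "aff_dim (lattice_polytope A) < int (DIM(real^3))"
      unfolding lattice_polytope_def by (simp add: aff_dim_convex_hull)
    then have "interior (lattice_polytope A) = {}"
      by (metis aff_dim_nonempty_interior less_irrefl)
    moreover have "convex (lattice_polytope A)" unfolding lattice_polytope_def by simp
    ultimately have "negligible (lattice_polytope A)"
      using negligible_convex_interior by blast
    then show False using cA(2) by (simp add: negligible_imp_measure0)
  qed
  have "lattice_point ` A \<subseteq> lattice_point ` B"
  proof
    fix x assume "x \<in> lattice_point ` A"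
    then have "x extreme_point_of (convex hull (lattice_point ` A))"
      using extreme_point_of_convex_hull_affine_independent[OF indep] by simp
    then show "x \<in> lattice_point ` B"
      using eq extreme_point_of_convex_hull unfolding lattice_polytope_def by metis
  qed
  then have "A \<subseteq> B" using inj by (auto simp: inj_on_def subset_iff)
  then show ?thesis using card_seteq[OF B(1)] B(2) cA(1) by simp
qed

section \<open>Valuation ring, maximal ideal and residue characteristic\<close>

locale valued_field =
  fixes v :: "'k::field \<Rightarrow> real"
  assumes valuation: "is_valuation v"
begin

text \<open>Zero is a separate case because \<open>v 0\<close> carries no information.\<close>

definition integral_elt :: "'k \<Rightarrow> bool" where
  "integral_elt x \<longleftrightarrow> x = 0 \<or> v x \<ge> 0"

abbreviation (input) small :: "'k \<Rightarrow> bool" where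
  "small x \<equiv> x \<in> valuation_ideal v"

lemma small_iff: "small x \<longleftrightarrow> x = 0 \<or> v x > 0"
  by (simp add: valuation_ideal_def)

lemma v_mult: "x \<noteq> 0 \<Longrightarrow> y \<noteq> 0 \<Longrightarrow> v (x * y) = v x + v y"
  and v_add: "x \<noteq> 0 \<Longrightarrow> y \<noteq> 0 \<Longrightarrow> x + y \<noteq> 0 \<Longrightarrow> v (x + y) \<ge> min (v x) (v y)"
  using valuation unfolding is_valuation_def by blast+

lemma v_one: "v 1 = 0"
  using v_mult[of 1 1] by simp

lemma v_minus_one: "v (- 1) = 0"
  using v_mult[of "- 1" "- 1"] v_one by simp

lemma v_minus: "x \<noteq> 0 \<Longrightarrow> v (- x) = v x"
  using v_mult[of "- 1" x] v_minus_one by simp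

lemma v_divide: "x \<noteq> 0 \<Longrightarrow> y \<noteq> 0 \<Longrightarrow> v (x / y) = v x - v y"
  using v_mult[of "x / y" y] by simp

lemma v_power: "x \<noteq> 0 \<Longrightarrow> v (x ^ n) = real n * v x"
  by (induction n) (simp_all add: v_one v_mult algebra_simps)

lemma v_prod: "finite A \<Longrightarrow> (\<And>i. i \<in> A \<Longrightarrow> x i \<noteq> 0) \<Longrightarrow> v (\<Prod>i\<in>A. x i) = (\<Sum>i\<in>A. v (x i))"
  by (induction A rule: finite_induct) (simp_all add: v_one v_mult)

lemma integral_elt_0 [simp]: "integral_elt 0" and integral_elt_1 [simp]: "integral_elt 1"
  by (simp_all add: integral_elt_def v_one)

lemma integral_elt_add: "integral_elt x \<Longrightarrow> integral_elt y \<Longrightarrow> integral_elt (x + y)"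
  using v_add[of x y] unfolding integral_elt_def by force

lemma integral_elt_mult: "integral_elt x \<Longrightarrow> integral_elt y \<Longrightarrow> integral_elt (x * y)"
  using v_mult[of x y] unfolding integral_elt_def by force

lemma integral_elt_sum: "(\<And>i. i \<in> A \<Longrightarrow> integral_elt (x i)) \<Longrightarrow> integral_elt (\<Sum>i\<in>A. x i)"
  by (induction A rule: infinite_finite_induct) (simp_all add: integral_elt_add)

lemma small_0 [simp]: "small 0"
  by (simp add: small_iff)

lemma small_add: "small x \<Longrightarrow> small y \<Longrightarrow> small (x + y)"
  using v_add[of x y] unfolding small_iff by force

lemma small_minus: "small x \<Longrightarrow> small (- x)"
  using v_minus[of x] unfolding small_iff by (cases "x = 0") auto

lemma small_diff: "small x \<Longrightarrow> small y \<Longrightarrow> small (x - y)"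
  using small_add[OF _ small_minus, of x y] by simp

lemma small_mult: "small x \<Longrightarrow> integral_elt y \<Longrightarrow> small (x * y)"
  using v_mult[of x y] unfolding small_iff integral_elt_def by force

lemma small_sum: "(\<And>i. i \<in> A \<Longrightarrow> small (x i)) \<Longrightarrow> small (\<Sum>i\<in>A. x i)"
  by (induction A rule: infinite_finite_induct) (simp_all add: small_add)

lemma one_not_small: "\<not> small 1"
  by (simp add: small_iff v_one)

text \<open>If 2 lay in the maximal ideal, the coset of 1 + 1 would be the ideal itself while that
  of 1 is not, so the residue characteristic would be exactly 2.\<close>

lemma two_not_small:
  assumes "ring_characteristic (residue_field v) \<noteq> 2"
  shows "\<not> small 2"
proof
  assume two: "small 2"
  let ?R = "residue_field v" and ?I = "valuation_ideal v"
  have one: "\<one>\<^bsub>?R\<^esub> = (\<lambda>h. h + 1) ` ?I" and zero: "\<zero>\<^bsub>?R\<^esub> = ?I"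
    and add: "A \<oplus>\<^bsub>?R\<^esub> B = {x + y | x y. x \<in> A \<and> y \<in> B}" for A B
    by (auto simp: residue_field_def FactRing_def valuation_ring_def a_r_coset_def r_coset_def
        set_add_def set_mult_def)
  \<comment> \<open>Addition in the quotient ring is elementwise addition of cosets, so the
    multiples of the unit can be computed as explicit sets, starting from the ideal at 0.\<close>
  have pow: "add_pow ?R (Suc n) \<one>\<^bsub>?R\<^esub> =
      {x + (h + 1) | x h. x \<in> add_pow ?R n \<one>\<^bsub>?R\<^esub> \<and> h \<in> ?I}" for n
  proof -
    have "add_pow ?R (Suc n) \<one>\<^bsub>?R\<^esub> = add_pow ?R n \<one>\<^bsub>?R\<^esub> \<oplus>\<^bsub>?R\<^esub> \<one>\<^bsub>?R\<^esub>"
      by (simp add: add_pow_def nat_pow_def)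
    then show ?thesis unfolding add unfolding one by blast
  qed
  have pow0: "add_pow ?R (0::nat) \<one>\<^bsub>?R\<^esub> = ?I"
    by (simp add: add_pow_def nat_pow_def zero)
  have p1: "add_pow ?R (Suc 0) \<one>\<^bsub>?R\<^esub> = {x + (h + 1) | x h. x \<in> ?I \<and> h \<in> ?I}"
    unfolding pow pow0 ..
  have "add_pow ?R (1::nat) \<one>\<^bsub>?R\<^esub> \<noteq> \<zero>\<^bsub>?R\<^esub>"
  proof -
    have "1 = (0::'k) + (0 + 1)" by simp
    then have "1 \<in> add_pow ?R (Suc 0) \<one>\<^bsub>?R\<^esub>" unfolding p1 using small_0 by blast
    then show ?thesis using one_not_small zero by auto
  qed
  then have not1: "\<not> (1 > (0::nat) \<and> add_pow ?R (1::nat) \<one>\<^bsub>?R\<^esub> = \<zero>\<^bsub>?R\<^esub>)" by simp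
  have "add_pow ?R (Suc 1) \<one>\<^bsub>?R\<^esub> = {y + (h' + 1) | y h'. y \<in> {x + (h + 1) | x h. x \<in> ?I \<and> h \<in> ?I} \<and> h' \<in> ?I}"
    unfolding One_nat_def pow[of "Suc 0"] p1 ..
  also have "\<dots> = ?I"
  proof safe
    fix x h h' assume "small x" "small h" "small h'"
    then have "small (x + h + h' + 2)" using two by (intro small_add)
    then show "small (x + (h + 1) + (h' + 1))" by (simp add: algebra_simps)
  next
    fix x assume "small x"
    then have "small (x - 2)" using two by (rule small_diff)
    moreover have "x = (x - 2) + (0 + 1) + (0 + 1)" by simp
    ultimately show "\<exists>y h'. x = y + (h' + 1) \<and> y \<in> {x + (h + 1) | x h. x \<in> ?I \<and> h \<in> ?I} \<and> h' \<in> ?I"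
      using small_0 by blast
  qed
  finally have is2: "2 > (0::nat) \<and> add_pow ?R (2::nat) \<one>\<^bsub>?R\<^esub> = \<zero>\<^bsub>?R\<^esub>"
    by (simp add: zero numeral_2_eq_2)
  have "(LEAST n. n > (0::nat) \<and> add_pow ?R n \<one>\<^bsub>?R\<^esub> = \<zero>\<^bsub>?R\<^esub>) = 2"
  proof (rule Least_equality)
    show "2 > (0::nat) \<and> add_pow ?R (2::nat) \<one>\<^bsub>?R\<^esub> = \<zero>\<^bsub>?R\<^esub>" by (rule is2)
  next
    fix n :: nat assume "n > 0 \<and> add_pow ?R n \<one>\<^bsub>?R\<^esub> = \<zero>\<^bsub>?R\<^esub>"
    then show "2 \<le> n" using not1 by (cases "n = 1") auto
  qed
  moreover have "\<exists>n>0::nat. add_pow ?R n \<one>\<^bsub>?R\<^esub> = \<zero>\<^bsub>?R\<^esub>" using is2 by blast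
  ultimately have "ring_characteristic ?R = 2" unfolding ring_characteristic_def by simp
  then show False using assms by simp
qed

lemma integral_coeff_mult:
  assumes "\<And>n. integral_elt (coeff P n)" "\<And>n. integral_elt (coeff Q n)"
  shows "integral_elt (coeff (P * Q) n)"
  unfolding coeff_mult using assms by (intro integral_elt_sum integral_elt_mult)

lemma integral_coeff_power:
  assumes "\<And>n. integral_elt (coeff P n)"
  shows "integral_elt (coeff (P ^ k) n)"
  by (induction k arbitrary: n) (simp_all add: coeff_1 integral_coeff_mult assms)

lemma integral_coeff_prod:
  assumes "\<And>i n. i \<in> A \<Longrightarrow> integral_elt (coeff (P i) n)"
  shows "integral_elt (coeff (\<Prod>i\<in>A. P i) n)"
  using assms
  by (induction A arbitrary: n rule: infinite_finite_induct) (simp_all add: coeff_1 integral_coeff_mult)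

end

section \<open>Restricting the initial form to a parametrized line\<close>

text \<open>This lets vanishing at every parameter of a line be turned into vanishing of all
  coefficients. Over a finite field the polynomial taking the value 1 everywhere, built below, would
  have no root.\<close>

lemma infinite_UNIV_alg_closed: "infinite (UNIV :: 'k::alg_closed_field set)"
proof
  assume fin: "finite (UNIV :: 'k set)"
  define P where "P = (\<Prod>a\<in>(UNIV :: 'k set). [:- a, 1:]) + 1"
  have ev: "poly P x = 1" for x :: 'k
    using fin by (simp add: P_def poly_prod)
  have "P \<noteq> 0" using ev[of 0] by auto
  moreover have "(\<Prod>a\<in>(UNIV :: 'k set). [:- a, 1:]) \<noteq> 0" using fin by simp
  moreover have "degree (\<Prod>a\<in>(UNIV :: 'k set). [:- a, 1:]) = card (UNIV :: 'k set)"
    using fin by (subst degree_prod_eq_sum_degree) auto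
  moreover have "card (UNIV :: 'k set) > 0" using fin by (simp add: card_gt_0_iff)
  ultimately have "degree P > 0" unfolding P_def by (subst degree_add_eq_left) auto
  then obtain x where "poly P x = 0" using alg_closed_imp_poly_has_root by blast
  then show False using ev by simp
qed

context valued_field
begin

text \<open>Substituting a parametrized line into \<open>f\<close> and rescaling turns the terms of \<open>f\<close> that are
  minimal at \<open>p\<close> into units and the others into elements of the maximal ideal, so the initial form
  of \<open>f\<close> at \<open>p\<close> vanishes on the reduced line.\<close>

lemma initial_form_vanishes:
  fixes f :: "(nat^4) \<Rightarrow>\<^sub>0 'k" and p :: "real^4" and Y :: "4 \<Rightarrow> 'k poly" and \<tau> :: "4 \<Rightarrow> 'k"
  defines "T u \<equiv> v (Poly_Mapping.lookup f u) + pairing u p"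
  assumes inf: "infinite (UNIV :: 'k set)"
    and hom: "homogeneous_of_degree d f"
    and S: "S = {u \<in> Poly_Mapping.keys f. \<forall>x\<in>Poly_Mapping.keys f. T u \<le> T x}"
    and \<tau>: "\<And>n. \<tau> n \<noteq> 0" "\<And>n. v (\<tau> n) = p $ n + C"
    and Y: "\<And>n e. integral_elt (coeff (Y n) e)"
    and vanish: "\<And>z. eval_poly f (\<chi> n. \<tau> n * poly (Y n) z) = 0"
    and ne: "S \<noteq> {}"
  obtains g where "\<forall>u\<in>S. g u \<noteq> 0 \<and> v (g u) = 0"
    "\<forall>e. small (\<Sum>u\<in>S. g u * coeff (\<Prod>n\<in>UNIV. Y n ^ (u $ n)) e)"
proof -
  let ?K = "Poly_Mapping.keys f"
  define h where "h u = Poly_Mapping.lookup f u * (\<Prod>n\<in>UNIV. \<tau> n ^ (u $ n))" for u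
  define Q where "Q u = (\<Prod>n\<in>UNIV. Y n ^ (u $ n))" for u :: "nat^4"
  have h0: "h u \<noteq> 0" if "u \<in> ?K" for u using that \<tau>(1) by (simp add: h_def in_keys_iff)
  \<comment> \<open>By homogeneity the common shift \<open>C\<close> contributes the same
    \<open>d * C\<close> to every term, so the order of the terms at \<open>p\<close> is
    preserved.\<close>
  have vh: "v (h u) = T u + real d * C" if u: "u \<in> ?K" for u
  proof -
    have "v (h u) = v (Poly_Mapping.lookup f u) + (\<Sum>n\<in>UNIV. real (u $ n) * (p $ n + C))"
      using u \<tau> by (simp add: h_def in_keys_iff v_mult v_prod v_power)
    also have "(\<Sum>n\<in>UNIV. real (u $ n) * (p $ n + C)) = pairing u p + real (\<Sum>n\<in>UNIV. u $ n) * C"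
      by (simp add: pairing_def distrib_left sum.distrib sum_distrib_right)
    also have "(\<Sum>n\<in>UNIV. u $ n) = d" using hom u unfolding homogeneous_of_degree_def by blast
    finally show ?thesis unfolding T_def by simp
  qed
  define P where "P = (\<Sum>u\<in>?K. smult (h u) (Q u))"
  have "poly P z = 0" for z
  proof -
    have "poly P z = eval_poly f (\<chi> n. \<tau> n * poly (Y n) z)"
      unfolding P_def eval_poly_def h_def Q_def
      by (simp add: poly_sum poly_prod power_mult_distrib prod.distrib mult_ac)
    then show ?thesis using vanish by simp
  qed
  then have "P = 0" using inf poly_roots_finite[of P] by auto
  then have cP: "(\<Sum>u\<in>?K. h u * coeff (Q u) e) = 0" for e
    by (metis (no_types, lifting) P_def coeff_0 coeff_smult coeff_sum sum.cong)
  obtain u0 where u0: "u0 \<in> S" using ne by blast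
  then have u0K: "u0 \<in> ?K" using S by auto
  define g where "g u = h u / h u0" for u
  have vg: "v (g u) = T u - T u0" if "u \<in> ?K" for u
    unfolding g_def using h0[OF that] h0[OF u0K] by (simp add: v_divide vh that u0K)
  have unit: "g u \<noteq> 0 \<and> v (g u) = 0" if "u \<in> S" for u
  proof -
    have u: "u \<in> ?K" "T u = T u0" using that u0 unfolding S by (auto intro: antisym)
    then show ?thesis using vg[OF u(1)] h0[OF u(1)] h0[OF u0K] by (simp add: g_def)
  qed
  have sm: "small (g u)" if "u \<in> ?K - S" for u
  proof -
    obtain x where "x \<in> ?K" "T x < T u" using \<open>u \<in> ?K - S\<close> unfolding S by (auto simp: not_le)
    moreover have "T u0 \<le> T x" using u0 \<open>x \<in> ?K\<close> unfolding S by blast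
    ultimately show ?thesis using vg[of u] that by (simp add: small_iff)
  qed
  have iQ: "integral_elt (coeff (Q u) e)" for u e
    unfolding Q_def by (intro integral_coeff_prod integral_coeff_power Y)
  have "small (\<Sum>u\<in>S. g u * coeff (Q u) e)" for e
  proof -
    have "(\<Sum>u\<in>?K. g u * coeff (Q u) e) = (\<Sum>u\<in>?K. h u * coeff (Q u) e) / h u0"
      unfolding g_def by (simp add: sum_divide_distrib)
    then have "(\<Sum>u\<in>?K. g u * coeff (Q u) e) = 0" using cP by simp
    moreover have "(\<Sum>u\<in>?K. g u * coeff (Q u) e) =
        (\<Sum>u\<in>?K - S. g u * coeff (Q u) e) + (\<Sum>u\<in>S. g u * coeff (Q u) e)"
      by (rule sum.subset_diff) (auto simp: S)
    ultimately have "(\<Sum>u\<in>S. g u * coeff (Q u) e) = - (\<Sum>u\<in>?K - S. g u * coeff (Q u) e)"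
      by (simp add: eq_neg_iff_add_eq_0 add.commute)
    also have "small \<dots>" using sm iQ by (intro small_minus small_sum small_mult) auto
    finally show ?thesis .
  qed
  then show ?thesis using that unit unfolding Q_def by blast
qed

end

section \<open>Linear forms and normal form of a line\<close>

lemma two_linear_equations_three_unknowns:
  fixes a1 a2 a3 b1 b2 b3 :: "'k::field"
  obtains c1 c2 c3 where "c1 \<noteq> 0 \<or> c2 \<noteq> 0 \<or> c3 \<noteq> 0"
    "c1 * a1 + c2 * a2 + c3 * a3 = 0" "c1 * b1 + c2 * b2 + c3 * b3 = 0"
proof -
  \<comment> \<open>Pivoting on \<open>x1\<close>: clearing the first column leaves one equation in
    two unknowns, solved by swapping its coefficients with a sign.\<close>
  have elim: "\<exists>c1 c2 c3. (c1 \<noteq> 0 \<or> c2 \<noteq> 0 \<or> c3 \<noteq> 0) \<and>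
      c1 * x1 + c2 * x2 + c3 * x3 = 0 \<and> c1 * y1 + c2 * y2 + c3 * y3 = 0"
    if x1: "x1 \<noteq> 0" for x1 x2 x3 y1 y2 y3 :: 'k
  proof -
    define q where "q = y1 / x1"
    obtain c2 c3 where c: "c2 \<noteq> 0 \<or> c3 \<noteq> 0" "c2 * (y2 - q * x2) + c3 * (y3 - q * x3) = 0"
    proof (cases "y2 - q * x2 = 0 \<and> y3 - q * x3 = 0")
      case True
      then show ?thesis using that[of 1 0] by simp
    next
      case False
      then show ?thesis using that[of "y3 - q * x3" "- (y2 - q * x2)"] by (auto simp: algebra_simps)
    qed
    define c1 where "c1 = - (c2 * x2 + c3 * x3) / x1"
    have 1: "c1 * x1 + c2 * x2 + c3 * x3 = 0" using x1 by (simp add: c1_def)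
    have "c1 * y1 + c2 * y2 + c3 * y3 = q * (c1 * x1 + c2 * x2 + c3 * x3) +
        (c2 * (y2 - q * x2) + c3 * (y3 - q * x3))"
      using x1 by (simp add: q_def algebra_simps)
    then have "c1 * y1 + c2 * y2 + c3 * y3 = 0" using 1 c(2) by simp
    then show ?thesis using 1 c(1) by blast
  qed
  show ?thesis
  proof (cases "a1 = 0")
    case False
    then show ?thesis using elim[of a1 a2 a3 b1 b2 b3] that by blast
  next
    case a: True
    show ?thesis
    proof (cases "b1 = 0")
      case False
      then show ?thesis using elim[of b1 b2 b3 a1 a2 a3] that by blast
    next
      case True
      then show ?thesis using a that[of 1 0 0] by simp
    qed
  qed
qed

lemma UNIV_4_distinct: "distinct [i, j, k, m] \<Longrightarrow> (UNIV :: 4 set) = {i, j, k, m}"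
  by (rule sym, rule card_subset_eq) auto

lemma sum_UNIV_4_distinct:
  assumes "distinct [i, j, k, m]"
  shows "(\<Sum>n\<in>(UNIV :: 4 set). g n) = g i + g j + g k + (g m :: 'b::comm_monoid_add)"
  unfolding UNIV_4_distinct[OF assms] using assms by (simp add: add.assoc)

lemma prod_UNIV_4_distinct:
  assumes "distinct [i, j, k, m]"
  shows "(\<Prod>n\<in>(UNIV :: 4 set). g n) = g i * g j * g k * (g m :: 'b::comm_monoid_mult)"
  unfolding UNIV_4_distinct[OF assms] using assms by (simp add: mult.assoc)

text \<open>A line is spanned by two vectors, which impose two conditions on the three coefficients
  of a form without \<open>x $ m\<close>.\<close>

lemma linear_form_vanishing_on_line:
  fixes l :: "('k::field^4) set"
  assumes l: "projective_line l" and d: "distinct [i, j, k, m]"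
  obtains c :: "4 \<Rightarrow> 'k" where "c \<noteq> (\<lambda>_. 0)" "c m = 0"
    "\<And>x. x \<in> l \<Longrightarrow> (\<Sum>n\<in>UNIV. c n * x $ n) = 0"
proof -
  have sub: "vec.subspace l" "vec.dim l = 2" using l unfolding projective_line_def by auto
  obtain B where B: "B \<subseteq> l" "vec.independent B" "l \<subseteq> vec.span B" "card B = 2"
    using vec.basis_exists[of l] sub(2) by metis
  obtain x y where xy: "B = {x, y}" using B(4) card_2_iff by metis
  obtain c1 c2 c3 where c: "c1 \<noteq> 0 \<or> c2 \<noteq> 0 \<or> c3 \<noteq> 0"
    "c1 * x $ i + c2 * x $ j + c3 * x $ k = 0" "c1 * y $ i + c2 * y $ j + c3 * y $ k = 0"
    by (rule two_linear_equations_three_unknowns)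
  define c where "c n = (if n = i then c1 else if n = j then c2 else if n = k then c3 else 0)" for n
  have eq: "(\<Sum>n\<in>UNIV. c n * z $ n) = c1 * z $ i + c2 * z $ j + c3 * z $ k" for z :: "'k^4"
    using d unfolding sum_UNIV_4_distinct[OF d] c_def by auto
  have "vec.subspace {z. (\<Sum>n\<in>UNIV. c n * z $ n) = 0}"
    by (rule vec.subspaceI)
      (simp_all add: distrib_left sum.distrib mult.left_commute sum_distrib_left[symmetric])
  moreover have "B \<subseteq> {z. (\<Sum>n\<in>UNIV. c n * z $ n) = 0}" unfolding xy eq using c by simp
  ultimately have "vec.span B \<subseteq> {z. (\<Sum>n\<in>UNIV. c n * z $ n) = 0}" by (rule vec.span_minimal[rotated])
  then have "\<And>z. z \<in> l \<Longrightarrow> (\<Sum>n\<in>UNIV. c n * z $ n) = 0" using B(3) by auto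
  moreover have "c m = 0" using d by (auto simp: c_def)
  moreover have "c i = c1" "c j = c2" "c k = c3" using d by (auto simp: c_def)
  then have "c \<noteq> (\<lambda>_. 0)" using c(1) by metis
  ultimately show ?thesis using that by blast
qed

lemma trop_of_line_linear_form:
  fixes c :: "4 \<Rightarrow> 'k::field"
  assumes c: "c \<noteq> (\<lambda>_. 0)" "\<And>x. x \<in> l \<Longrightarrow> (\<Sum>n\<in>UNIV. c n * x $ n) = 0"
    and w: "w \<in> trop_of_line v l"
  shows "min_attained_twice {n. c n \<noteq> 0} (\<lambda>n. v (c n) + w $ n)"
proof -
  define e where "e n = axis n (1::nat)" for n :: 4
  have inj: "inj e" by (rule injI) (simp add: e_def axis_eq_axis)
  define g where "g = (\<Sum>n\<in>UNIV. Poly_Mapping.single (e n) (c n))"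
  have lookup: "Poly_Mapping.lookup g (e n) = c n" for n
    unfolding g_def by (simp add: lookup_sum lookup_single when_def inj_eq[OF inj])
  have keys: "Poly_Mapping.keys g = e ` {n. c n \<noteq> 0}"
  proof
    show "Poly_Mapping.keys g \<subseteq> e ` {n. c n \<noteq> 0}"
    proof
      fix u assume "u \<in> Poly_Mapping.keys g"
      then have "(\<Sum>n\<in>UNIV. c n when e n = u) \<noteq> 0"
        unfolding g_def in_keys_iff by (simp add: lookup_sum lookup_single)
      then obtain n where "(c n when e n = u) \<noteq> 0" by (meson sum.neutral)
      then show "u \<in> e ` {n. c n \<noteq> 0}" by (auto simp: when_def split: if_splits)
    qed
  qed (auto simp: in_keys_iff lookup)
  have "g \<noteq> 0" using c(1) lookup by (metis lookup_zero ext)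
  moreover have "homogeneous_of_degree 1 g"
    unfolding homogeneous_of_degree_def keys by (auto simp: e_def axis_def)
  moreover have "vanishes_on g l"
    unfolding vanishes_on_def
  proof
    fix x assume x: "x \<in> l"
    have mono: "(\<Prod>i\<in>UNIV. (x $ i) ^ (e n $ i)) = x $ n" for n
    proof -
      have "(\<Prod>i\<in>UNIV. (x $ i) ^ (e n $ i)) = (\<Prod>i\<in>UNIV. if i = n then x $ i else 1)"
        by (intro prod.cong) (auto simp: e_def axis_def)
      then show ?thesis by simp
    qed
    have "eval_poly g x = (\<Sum>n\<in>{n. c n \<noteq> 0}. c n * x $ n)"
      unfolding eval_poly_def keys using inj
      by (subst sum.reindex) (auto simp: lookup mono intro: inj_on_subset)
    also have "\<dots> = (\<Sum>n\<in>UNIV. c n * x $ n)"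
      by (rule sum.mono_neutral_left) auto
    finally show "eval_poly g x = 0" using c(2)[OF x] by simp
  qed
  ultimately have "w \<in> trop_hypersurface v g" using w unfolding trop_of_line_def by blast
  then have "min_attained_twice (e ` {n. c n \<noteq> 0}) (\<lambda>u. v (Poly_Mapping.lookup g u) + pairing u w)"
    unfolding trop_hypersurface_def keys by simp
  moreover have "pairing (e n) w = w $ n" for n
  proof -
    have "pairing (e n) w = (\<Sum>i\<in>UNIV. if i = n then w $ i else 0)"
      unfolding pairing_def by (intro sum.cong) (auto simp: e_def axis_def)
    then show ?thesis by simp
  qed
  ultimately show ?thesis
    using inj by (simp add: min_attained_twice_image lookup inj_on_subset[OF inj])
qed

text \<open>Far out on the ray in direction \<open>z\<close> the \<open>z\<close>-term is too large
  to tie, so the other two terms must both be present and equal. Each ray thus reveals one equality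
  of valuations.\<close>

lemma min_attained_twice_along_ray:
  fixes A :: "'a \<Rightarrow> real"
  assumes S: "S \<subseteq> {x, y, z}" and d: "distinct [x, y, z]"
    and ray: "\<And>t. t \<ge> 0 \<Longrightarrow> min_attained_twice S (\<lambda>n. A n + (if n = z then t else 0))"
  shows "x \<in> S \<and> y \<in> S \<and> A x = A y"
proof -
  define t where "t = \<bar>A x\<bar> + \<bar>A y\<bar> + \<bar>A z\<bar> + 1"
  have t: "t \<ge> 0" by (simp add: t_def)
  have fS: "finite S" using S finite_subset by blast
  obtain u u' where u: "u \<in> S" "u' \<in> S" "u \<noteq> u'"
    "A u + (if u = z then t else 0) = A u' + (if u' = z then t else 0)"
    using ray[OF t] unfolding min_attained_twice_iff[OF fS] by blast
  have "u \<noteq> z" "u' \<noteq> z" using u S d by (auto simp: t_def split: if_splits)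
  then have "u = x \<and> u' = y \<or> u = y \<and> u' = x" using u(1-3) S by blast
  then show ?thesis using u \<open>u \<noteq> z\<close> \<open>u' \<noteq> z\<close> by auto
qed

lemma tropical_line_swap:
  "tropical_line p a j i k l = tropical_line p a i j k l"
  "tropical_line p a i j l k = tropical_line p a i j k l"
  unfolding tropical_line_def by (auto simp: add.commute[of "trop_e j" "trop_e i"]; blast)+

lemma trop_rays_in_tropical_line:
  assumes "t \<ge> 0"
  shows "p + t *\<^sub>R trop_e k \<in> tropical_line p a i j k l"
    "p + t *\<^sub>R trop_e l \<in> tropical_line p a i j k l"
    "p + a *\<^sub>R (trop_e i + trop_e j) + t *\<^sub>R trop_e i \<in> tropical_line p a i j k l"
    "p + a *\<^sub>R (trop_e i + trop_e j) + t *\<^sub>R trop_e j \<in> tropical_line p a i j k l"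
proof -
  have intro: "q \<in> tropical_line p a i j k l"
    if "(\<exists>t\<ge>0. q = p + t *\<^sub>R trop_e k \<or> q = p + t *\<^sub>R trop_e l) \<or>
        (\<exists>t\<ge>0. q = p + a *\<^sub>R (trop_e i + trop_e j) + t *\<^sub>R trop_e i \<or>
               q = p + a *\<^sub>R (trop_e i + trop_e j) + t *\<^sub>R trop_e j)" for q
    unfolding tropical_line_def using that by (intro CollectI exI[of _ q] exI[of _ 0]) simp
  show "p + t *\<^sub>R trop_e k \<in> tropical_line p a i j k l"
    "p + t *\<^sub>R trop_e l \<in> tropical_line p a i j k l"
    "p + a *\<^sub>R (trop_e i + trop_e j) + t *\<^sub>R trop_e i \<in> tropical_line p a i j k l"
    "p + a *\<^sub>R (trop_e i + trop_e j) + t *\<^sub>R trop_e j \<in> tropical_line p a i j k l"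
    by (rule intro; use assms in blast)+
qed

context valued_field
begin

text \<open>The form in \<open>x\<^sub>i, x\<^sub>k, x\<^sub>m\<close> vanishing on \<open>l\<close> has, at \<open>p\<close>, three terms of equal valuation, and
  rescaling turns it into \<open>y\<^sub>m = y\<^sub>k + y\<^sub>i\<close>. The one in \<open>x\<^sub>i, x\<^sub>j, x\<^sub>k\<close> becomes
  \<open>y\<^sub>j = y\<^sub>i + A y\<^sub>k\<close>, where \<open>v A\<close> is the length of the bounded edge.\<close>

lemma line_normal_form:
  fixes l :: "('k^4) set"
  assumes l: "projective_line l" and d: "distinct [i, j, k, m]"
    and trop: "trop_of_line v l = tropical_line p a i j k m"
  obtains \<tau> A C where "\<forall>n. \<tau> n \<noteq> 0" "\<forall>n. v (\<tau> n) = p $ n + C" "A \<noteq> 0" "v A = a"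
    "\<forall>z. (\<chi> n. \<tau> n * (if n = i then z else if n = j then z + A else if n = k then 1 else 1 + z)) \<in> l"
proof -
  have d1: "distinct [i, k, m, j]" and d2: "distinct [i, j, k, m]" using d by auto
  obtain c where c: "c \<noteq> (\<lambda>_. 0)" "c j = 0" "\<And>x. x \<in> l \<Longrightarrow> (\<Sum>n\<in>UNIV. c n * x $ n) = 0"
    using linear_form_vanishing_on_line[OF l d1] by blast
  obtain e where e: "e \<noteq> (\<lambda>_. 0)" "e m = 0" "\<And>x. x \<in> l \<Longrightarrow> (\<Sum>n\<in>UNIV. e n * x $ n) = 0"
    using linear_form_vanishing_on_line[OF l d2] by blast
  have U: "n \<in> {i, j, k, m}" for n using UNIV_4_distinct[OF d] by blast
  have cS: "{n. c n \<noteq> 0} \<subseteq> {i, k, m}" using U c(2) by blast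
  have eS: "{n. e n \<noteq> 0} \<subseteq> {i, j, k}" using U e(2) by blast
  have c_trop: "min_attained_twice {n. c n \<noteq> 0} (\<lambda>n. v (c n) + w $ n)"
    if "w \<in> tropical_line p a i j k m" for w
    using trop_of_line_linear_form[of c l w v] c(1,3) that unfolding trop by blast
  have e_trop: "min_attained_twice {n. e n \<noteq> 0} (\<lambda>n. v (e n) + w $ n)"
    if "w \<in> tropical_line p a i j k m" for w
    using trop_of_line_linear_form[of e l w v] e(1,3) that unfolding trop by blast
  have ck: "i \<in> {n. c n \<noteq> 0} \<and> m \<in> {n. c n \<noteq> 0} \<and> v (c i) + p $ i = v (c m) + p $ m"
  proof (rule min_attained_twice_along_ray[where z = k])
    fix t :: real assume "t \<ge> 0"
    from c_trop[OF trop_rays_in_tropical_line(1)[OF this]]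
    show "min_attained_twice {n. c n \<noteq> 0} (\<lambda>n. (v (c n) + p $ n) + (if n = k then t else 0))"
      by (rule min_attained_twice_cong[THEN iffD1, rotated]) (auto simp: axis_def)
  qed (use cS d in auto)
  have cm: "i \<in> {n. c n \<noteq> 0} \<and> k \<in> {n. c n \<noteq> 0} \<and> v (c i) + p $ i = v (c k) + p $ k"
  proof (rule min_attained_twice_along_ray[where z = m])
    fix t :: real assume "t \<ge> 0"
    from c_trop[OF trop_rays_in_tropical_line(2)[OF this]]
    show "min_attained_twice {n. c n \<noteq> 0} (\<lambda>n. (v (c n) + p $ n) + (if n = m then t else 0))"
      by (rule min_attained_twice_cong[THEN iffD1, rotated]) (auto simp: axis_def)
  qed (use cS d in auto)
  \<comment> \<open>The term values at the second vertex
    \<open>p + a *\<^sub>R (trop_e i + trop_e j)\<close>. The index \<open>m\<close> does not occur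
    in the form \<open>e\<close>, so among the relevant indices only \<open>k\<close> is
    unshifted.\<close>
  define B where "B n = v (e n) + p $ n + (if n = k then 0 else a)" for n
  have ei: "j \<in> {n. e n \<noteq> 0} \<and> k \<in> {n. e n \<noteq> 0} \<and> B j = B k"
  proof (rule min_attained_twice_along_ray[where z = i])
    fix t :: real assume "t \<ge> 0"
    from e_trop[OF trop_rays_in_tropical_line(3)[OF this]]
    show "min_attained_twice {n. e n \<noteq> 0} (\<lambda>n. B n + (if n = i then t else 0))"
      by (rule min_attained_twice_cong[THEN iffD1, rotated]) (use eS d in \<open>auto simp: axis_def B_def\<close>)
  qed (use eS d in auto)
  have ej: "i \<in> {n. e n \<noteq> 0} \<and> k \<in> {n. e n \<noteq> 0} \<and> B i = B k"
  proof (rule min_attained_twice_along_ray[where z = j])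
    fix t :: real assume "t \<ge> 0"
    from e_trop[OF trop_rays_in_tropical_line(4)[OF this]]
    show "min_attained_twice {n. e n \<noteq> 0} (\<lambda>n. B n + (if n = j then t else 0))"
      by (rule min_attained_twice_cong[THEN iffD1, rotated]) (use eS d in \<open>auto simp: axis_def B_def\<close>)
  qed (use eS d in auto)
  have nz: "c i \<noteq> 0" "c k \<noteq> 0" "c m \<noteq> 0" "e i \<noteq> 0" "e j \<noteq> 0" "e k \<noteq> 0"
    using ck cm ei ej by auto
  \<comment> \<open>With \<open>x n = \<tau> n * y n\<close>, the form \<open>c\<close> becomes
    \<open>y i + y k - y m\<close>; multiplying \<open>e\<close> by \<open>c i / e i\<close> gives
    \<open>y i - y j + A * y k\<close>, which dictates \<open>\<tau> j\<close> and
    \<open>A\<close>.\<close>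
  define \<tau> where "\<tau> n = (if n = i then 1 / c i else if n = j then - (e i / (c i * e j))
    else if n = k then 1 / c k else - (1 / c m))" for n
  define A where "A = e k * c i / (e i * c k)"
  define C where "C = - (v (c i) + p $ i)"
  have \<tau>_eq: "\<tau> i = 1 / c i" "\<tau> j = - (e i / (c i * e j))" "\<tau> k = 1 / c k" "\<tau> m = - (1 / c m)"
    using d by (auto simp: \<tau>_def)
  have \<tau>0: "\<tau> n \<noteq> 0" for n unfolding \<tau>_def using nz by auto
  have A0: "A \<noteq> 0" using nz by (simp add: A_def)
  have BB: "B i = v (e i) + p $ i + a" "B j = v (e j) + p $ j + a" "B k = v (e k) + p $ k"
    using d by (auto simp: B_def)
  have vA: "v A = a"
    using nz cm ej BB by (simp add: A_def v_divide v_mult)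
  have "v (\<tau> i) = p $ i + C \<and> v (\<tau> j) = p $ j + C \<and> v (\<tau> k) = p $ k + C \<and> v (\<tau> m) = p $ m + C"
    unfolding \<tau>_eq C_def using nz cm ck ei ej BB by (simp add: v_minus v_divide v_mult v_one)
  then have v\<tau>: "v (\<tau> n) = p $ n + C" for n using U[of n] by auto
  \<comment> \<open>The solutions of the two normalized equations with \<open>(y i, y k)\<close>
    equal to (0, 1) and (1, 0).\<close>
  define b1 b2 :: "'k^4" where
    "b1 = (\<chi> n. \<tau> n * (if n = i then 0 else if n = j then A else 1))" and
    "b2 = (\<chi> n. \<tau> n * (if n = k then 0 else 1))"
  have "l \<subseteq> vec.span {b1, b2}"
  proof
    fix x assume x: "x \<in> l"
    have "c i * x $ i + c k * x $ k + c m * x $ m = 0"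
      using c(3)[OF x] unfolding sum_UNIV_4_distinct[OF d] by (simp add: c(2))
    then have "c k * x $ k + c i * x $ i = - (c m * x $ m)"
      by (simp add: eq_neg_iff_add_eq_0 add_ac)
    then have xm: "x $ m = \<tau> m * (c k * x $ k + c i * x $ i)"
      unfolding \<tau>_eq using nz by simp
    have "e i * x $ i + e j * x $ j + e k * x $ k = 0"
      using e(3)[OF x] unfolding sum_UNIV_4_distinct[OF d] by (simp add: e(2))
    then have "e k * x $ k + e i * x $ i = - (e j * x $ j)"
      by (simp add: eq_neg_iff_add_eq_0 add_ac)
    moreover have "c k * x $ k * A + c i * x $ i = c i / e i * (e k * x $ k + e i * x $ i)"
      using nz by (simp add: A_def field_simps)
    ultimately have xj: "x $ j = \<tau> j * (c k * x $ k * A + c i * x $ i)"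
      unfolding \<tau>_eq using nz by simp
    have "x $ n = ((c k * x $ k) *s b1 + (c i * x $ i) *s b2) $ n" for n
    proof -
      have "n = i \<or> n = j \<or> n = k \<or> n = m" using U[of n] by simp
      then show ?thesis
      proof (elim disjE)
        assume n: "n = i" then show ?thesis using d nz unfolding n by (auto simp: b1_def b2_def \<tau>_eq)
      next
        assume n: "n = j" show ?thesis using d xj unfolding n by (auto simp: b1_def b2_def algebra_simps)
      next
        assume n: "n = k" show ?thesis using d nz unfolding n by (auto simp: b1_def b2_def \<tau>_eq)
      next
        assume n: "n = m" show ?thesis using d xm unfolding n by (auto simp: b1_def b2_def algebra_simps)
      qed
    qed
    then have "x = (c k * x $ k) *s b1 + (c i * x $ i) *s b2" unfolding vec_eq_iff ..
    moreover have "\<dots> \<in> vec.span {b1, b2}"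
      by (intro vec.span_add vec.span_scale vec.span_base) auto
    ultimately show "x \<in> vec.span {b1, b2}" by simp
  qed
  \<comment> \<open>Equality follows from one inclusion by dimension: two vectors span at most
    dimension 2, which is the dimension of \<open>l\<close>.\<close>
  moreover have "vec.dim (vec.span {b1, b2}) \<le> vec.dim l"
  proof -
    have "vec.dim (vec.span {b1, b2}) \<le> card {b1, b2}" by (rule vec.dim_le_card) auto
    also have "\<dots> \<le> 2" by (simp add: card_insert_if)
    finally show ?thesis using l unfolding projective_line_def by simp
  qed
  ultimately have l_eq: "l = vec.span {b1, b2}"
    using l unfolding projective_line_def by (intro vec.subspace_dim_equal) auto
  have "(\<chi> n. \<tau> n * (if n = i then z else if n = j then z + A else if n = k then 1 else 1 + z)) \<in> l" for z
  proof -
    have "(\<chi> n. \<tau> n * (if n = i then z else if n = j then z + A else if n = k then 1 else 1 + z)) = b1 + z *s b2"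
      using d by (auto simp: vec_eq_iff b1_def b2_def algebra_simps)
    also have "\<dots> \<in> l" unfolding l_eq by (intro vec.span_add vec.span_scale vec.span_base) auto
    finally show ?thesis .
  qed
  then show ?thesis using that \<tau>0 v\<tau> A0 vA by blast
qed

end

section \<open>Normalizing the labels of the motif\<close>

lemma finite_tetrahedron_3I:
  "finite tetrahedron_3I_1" "card tetrahedron_3I_1 \<le> 4"
  "finite tetrahedron_3I_2" "card tetrahedron_3I_2 \<le> 4"
  unfolding tetrahedron_3I_1_def tetrahedron_3I_2_def by (simp_all add: card_insert_if)

text \<open>Only the edge joining \<open>x_0^3\<close> and \<open>x_0^2 x_3\<close> misses two
  variables at once. This pins the labels of the bounded direction, which the motif leaves
  open.\<close>

lemma tetrahedron_3I_edge:
  assumes S: "S = tetrahedron_3I_1 \<or> S = tetrahedron_3I_2"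
    and u: "u \<in> S" "u' \<in> S" "u \<noteq> u'" and ab: "a \<noteq> b"
    and zero: "u $ a = 0" "u $ b = 0" "u' $ a = 0" "u' $ b = 0"
  shows "{a, b} = {1, 2 :: 4}"
proof -
  have "\<forall>a b. a \<noteq> b \<longrightarrow> u $ a = 0 \<longrightarrow> u $ b = 0 \<longrightarrow> u' $ a = 0 \<longrightarrow> u' $ b = 0 \<longrightarrow>
      a = 1 \<and> b = 2 \<or> a = 2 \<and> b = 1"
    using S u(1,2,3) unfolding all_4_iff tetrahedron_3I_1_def tetrahedron_3I_2_def
    by (elim disjE; simp; elim disjE; simp)
  then show ?thesis using ab zero by blast
qed

lemma dual_cell_degree: "u \<in> dual_cell \<omega> p \<Longrightarrow> (\<Sum>i\<in>UNIV. u $ i) = 3"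
  unfolding dual_cell_def using exponent by auto

lemma pairing_add: "pairing u (w + w') = pairing u w + pairing u w'"
  unfolding pairing_def by (simp add: distrib_left sum.distrib)

lemma pairing_scale: "pairing u (c *\<^sub>R w) = c * pairing u w"
  unfolding pairing_def by (simp add: sum_distrib_left mult_ac)

lemma trop_cubic_eq_iff: "trop_term \<omega> w u = trop_cubic \<omega> w \<longleftrightarrow> (\<forall>u'. trop_term \<omega> w u \<le> trop_term \<omega> w u')"
proof
  assume "\<forall>u'. trop_term \<omega> w u \<le> trop_term \<omega> w u'"
  then show "trop_term \<omega> w u = trop_cubic \<omega> w"
    unfolding trop_cubic_def by (intro Min_eqI[symmetric]) auto
qed (simp add: trop_cubic_def)

text \<open>Both sides describe which points \<open>p + \<epsilon> *\<^sub>R w\<close> with small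
  positive \<open>\<epsilon>\<close> lie on the same set, seen once through \<open>\<omega>\<close>
  and once through \<open>f\<close>.\<close>

lemma surface_fan_eq_initial_fan:
  fixes v :: "'k::field \<Rightarrow> real" and f :: "(nat^4) \<Rightarrow>\<^sub>0 'k"
  defines "T u p \<equiv> v (Poly_Mapping.lookup f u) + pairing u p"
  assumes eq: "trop_surface \<omega> = trop_hypersurface v f"
  shows "min_attained_twice (dual_cell \<omega> p) (\<lambda>u. pairing u w) \<longleftrightarrow>
    min_attained_twice {u \<in> Poly_Mapping.keys f. \<forall>x\<in>Poly_Mapping.keys f. T u p \<le> T x p} (\<lambda>u. pairing u w)"
proof -
  let ?K = "Poly_Mapping.keys f" and ?S = "{u. trop_term \<omega> p u = trop_cubic \<omega> p}"
  have S: "?S = {u \<in> UNIV. \<forall>x\<in>UNIV. trop_term \<omega> p u \<le> trop_term \<omega> p x}"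
    unfolding trop_cubic_eq_iff by simp
  have inj: "inj_on exponent A" for A by (rule inj_onI) (simp add: exponent_inject)
  have 1: "\<forall>\<^sub>F \<epsilon> in at_right 0. (p + \<epsilon> *\<^sub>R w \<in> trop_surface \<omega>) \<longleftrightarrow>
      min_attained_twice (dual_cell \<omega> p) (\<lambda>u. pairing u w)"
    using min_attained_twice_near[OF finite S, of "\<lambda>u. pairing (exponent u) w"]
    unfolding dual_cell_def min_attained_twice_image[OF finite inj]
    by (rule eventually_mono)
      (simp add: trop_surface_def trop_term_def[abs_def] pairing_add pairing_scale add.assoc)
  have 2: "\<forall>\<^sub>F \<epsilon> in at_right 0. (p + \<epsilon> *\<^sub>R w \<in> trop_hypersurface v f) \<longleftrightarrow>
      min_attained_twice {u \<in> ?K. \<forall>x\<in>?K. T u p \<le> T x p} (\<lambda>u. pairing u w)"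
    using min_attained_twice_near[OF finite_keys refl, of f "\<lambda>u. T u p" "\<lambda>u. pairing u w"]
    by (rule eventually_mono)
      (simp add: trop_hypersurface_def T_def pairing_add pairing_scale add.assoc)
  from 1 2 have "\<forall>\<^sub>F \<epsilon>::real in at_right 0. min_attained_twice (dual_cell \<omega> p) (\<lambda>u. pairing u w) \<longleftrightarrow>
      min_attained_twice {u \<in> ?K. \<forall>x\<in>?K. T u p \<le> T x p} (\<lambda>u. pairing u w)"
    by eventually_elim (simp add: eq)
  then show ?thesis by (simp add: eventually_const_iff)
qed

text \<open>The type supplies \<open>\<pi>\<close> and the motif supplies \<open>i, j, k, m\<close>,
  independently of each other. Equal hulls identify the vertex sets, and the exit edge then matches
  the two labelings up to swaps within each pair.\<close>

lemma type_3I_normalized: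
  assumes type: "type_3I S \<omega> L" and S: "S = tetrahedron_3I_1 \<or> S = tetrahedron_3I_2"
  obtains p i j k m \<pi> where "distinct [i, j, k, m]" "bij \<pi>" "\<pi> i = 1" "\<pi> j = 2" "\<pi> k = 0" "\<pi> m = 3"
    "dual_cell \<omega> p = permute_coordinates \<pi> ` S" "\<And>a. a \<ge> 0 \<Longrightarrow> L a = tropical_line p a i j k m"
proof -
  obtain \<pi> where \<pi>: "bij \<pi>" "\<forall>a\<ge>0. dual_motif \<omega> (L a) = lattice_polytope (permute_coordinates \<pi> ` S)"
    using type unfolding type_3I_def by blast
  obtain p i j k m where ijkm: "distinct [i, j, k, m]" "four_exit_tetrahedron (dual_cell \<omega> p) i j k m"
    "\<forall>a\<ge>0. L a = tropical_line p a i j k m \<and> L a \<subseteq> trop_surface \<omega> \<and>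
                dual_motif \<omega> (L a) = lattice_polytope (dual_cell \<omega> p)"
    using type unfolding type_3I_def motif_3I_def by blast
  have S4: "finite S" "card S \<le> 4" using S finite_tetrahedron_3I by auto
  have degS: "(\<Sum>i\<in>UNIV. u $ i) = 3" if "u \<in> S" for u
    using S that unfolding tetrahedron_3I_1_def tetrahedron_3I_2_def sum_UNIV_4 by auto
  have deg: "(\<Sum>i\<in>UNIV. u $ i) = 3" if "u \<in> permute_coordinates \<pi> ` S" for u
  proof -
    obtain q where q: "q \<in> S" "u = permute_coordinates \<pi> q" using \<open>u \<in> permute_coordinates \<pi> ` S\<close> by blast
    have "(\<Sum>i\<in>UNIV. q $ \<pi> i) = (\<Sum>i\<in>UNIV. q $ i)" by (rule sum.reindex_bij_betw[OF \<pi>(1)])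
    then show ?thesis using degS[OF q(1)] q(2) by simp
  qed
  have cell: "dual_cell \<omega> p = permute_coordinates \<pi> ` S"
  proof (rule unimodular_eq_of_lattice_polytope_eq)
    show "unimodular_tetrahedron (dual_cell \<omega> p)" using ijkm(2) unfolding four_exit_tetrahedron_def by blast
    show "card (permute_coordinates \<pi> ` S) \<le> 4" using card_image_le[OF S4(1)] S4(2) le_trans by blast
    show "lattice_polytope (dual_cell \<omega> p) = lattice_polytope (permute_coordinates \<pi> ` S)"
      using ijkm(3) \<pi>(2) by (metis order_refl)
  qed (use deg dual_cell_degree S4 in auto)
  obtain u u' where u: "u \<in> dual_cell \<omega> p" "u' \<in> dual_cell \<omega> p" "u \<noteq> u'"
    "closed_segment (lattice_point u) (lattice_point u') \<subseteq> facet i \<inter> facet j"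
    using ijkm(2) unfolding four_exit_tetrahedron_def by blast
  then have "lattice_point u \<in> facet i \<inter> facet j" "lattice_point u' \<in> facet i \<inter> facet j" by auto
  then have z: "u $ i = 0" "u $ j = 0" "u' $ i = 0" "u' $ j = 0"
    using lattice_point_in_facet_imp dual_cell_degree u(1,2) by blast+
  obtain s s' where s: "s \<in> S" "s' \<in> S" "u = permute_coordinates \<pi> s" "u' = permute_coordinates \<pi> s'"
    using u(1,2) unfolding cell by blast
  have inj: "\<pi> x = \<pi> y \<longleftrightarrow> x = y" for x y using \<pi>(1) by (simp add: bij_def inj_eq)
  have ij: "{\<pi> i, \<pi> j} = {1, 2}"
    using tetrahedron_3I_edge[OF S s(1,2)] s u(3) z inj ijkm(1) by auto
  have "distinct [\<pi> i, \<pi> j, \<pi> k, \<pi> m]" using ijkm(1) inj by simp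
  then have km: "{\<pi> k, \<pi> m} = {0, 3}"
    using ij UNIV_4 UNIV_I[of "\<pi> k"] UNIV_I[of "\<pi> m"] unfolding UNIV_4 by (auto simp: doubleton_eq_iff)
  \<comment> \<open>The tropical line is symmetric within each pair of labels, so each case reduces
    to the standard one by renaming.\<close>
  consider "\<pi> i = 1 \<and> \<pi> j = 2 \<and> \<pi> k = 0 \<and> \<pi> m = 3" | "\<pi> i = 1 \<and> \<pi> j = 2 \<and> \<pi> k = 3 \<and> \<pi> m = 0"
    | "\<pi> i = 2 \<and> \<pi> j = 1 \<and> \<pi> k = 0 \<and> \<pi> m = 3" | "\<pi> i = 2 \<and> \<pi> j = 1 \<and> \<pi> k = 3 \<and> \<pi> m = 0"
    using ij km by (auto simp: doubleton_eq_iff)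
  then show ?thesis
  proof cases
    case 1
    show ?thesis by (rule that[of i j k m \<pi> p]) (use 1 \<pi> cell ijkm in auto)
  next
    case 2
    show ?thesis by (rule that[of i j m k \<pi> p]) (use 2 \<pi> cell ijkm in \<open>auto simp: tropical_line_swap\<close>)
  next
    case 3
    show ?thesis by (rule that[of j i k m \<pi> p]) (use 3 \<pi> cell ijkm in \<open>auto simp: tropical_line_swap\<close>)
  next
    case 4
    show ?thesis
      by (rule that[of j i m k \<pi> p])
        (use 4 \<pi> cell ijkm in \<open>auto simp: tropical_line_swap(1)[of p _ i j m k] tropical_line_swap(2)[of p _ i j k m]\<close>)
  qed
qed

section \<open>The residual relation and the contradiction\<close>

context valued_field
begin

text \<open>The initial form restricted to the normalized line, coefficient by coefficient modulo
  the maximal ideal. The variable \<open>x_0\<close> corresponds to \<open>k\<close> and is set to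
  1, so its exponent does not appear.\<close>

lemma residual_relation:
  fixes f :: "(nat^4) \<Rightarrow>\<^sub>0 'k" and s :: "4 \<Rightarrow> nat^4" and l :: "('k^4) set"
  assumes inf: "infinite (UNIV :: 'k set)" and frame: "unimodular_frame s W"
    and d: "distinct [i, j, k, m]" and \<pi>: "bij \<pi>" "\<pi> i = 1" "\<pi> j = 2" "\<pi> k = 0" "\<pi> m = 3"
    and cell: "dual_cell \<omega> p = permute_coordinates \<pi> ` range s"
    and f: "homogeneous_of_degree 3 f" "trop_surface \<omega> = trop_hypersurface v f"
    and l: "projective_line l" "vanishes_on f l" "trop_of_line v l = tropical_line p a i j k m"
    and a: "a > 0"
  obtains A g where "small A" "\<And>n. g n \<noteq> 0 \<and> v (g n) = 0"
    "\<And>e. small (\<Sum>n\<in>UNIV. g n *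
       coeff ([:0, 1:] ^ (s n $ 1) * [:A, 1:] ^ (s n $ 2) * [:1, 1:] ^ (s n $ 3)) e)"
proof -
  let ?K = "Poly_Mapping.keys f"
  let ?T = "\<lambda>u. v (Poly_Mapping.lookup f u) + pairing u p"
  define S where "S = {u \<in> ?K. \<forall>x\<in>?K. ?T u \<le> ?T x}"
  define s' where "s' n = permute_coordinates \<pi> (s n)" for n
  interpret unimodular_frame s' "\<lambda>n. \<chi> i. W n $ \<pi> i"
    unfolding s'_def by (rule unimodular_frame_permute[OF frame \<pi>(1)])
  have cell': "dual_cell \<omega> p = range s'" unfolding cell s'_def by auto
  have "S = range s'"
  proof (rule same_tropical_fan_imp_eq)
    show "finite S" unfolding S_def by simp
    show "(\<Sum>i\<in>UNIV. u $ i) = 3" if "u \<in> S" for u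
      using f(1) that unfolding S_def homogeneous_of_degree_def by blast
    show "min_attained_twice (range s') (\<lambda>u. pairing u w) \<longleftrightarrow> min_attained_twice S (\<lambda>u. pairing u w)" for w
      using surface_fan_eq_initial_fan[OF f(2), of p w] unfolding cell' S_def .
  qed
  obtain \<tau> A C where nf: "\<forall>n. \<tau> n \<noteq> 0" "\<forall>n. v (\<tau> n) = p $ n + C" "A \<noteq> 0" "v A = a"
    "\<forall>z. (\<chi> n. \<tau> n * (if n = i then z else if n = j then z + A else if n = k then 1 else 1 + z)) \<in> l"
    by (rule line_normal_form[OF l(1) d l(3)]) (rule that)
  have A: "small A" "integral_elt A" using nf(3,4) a by (auto simp: small_iff integral_elt_def)
  define Y where "Y n = (if n = i then [:0, 1:] else if n = j then [:A, 1:] else if n = k then 1 else [:1, 1:])" for n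
  have Yint: "integral_elt (coeff (Y n) e)" for n e
    unfolding Y_def using A(2) by (auto simp: coeff_pCons coeff_1 split: nat.splits)
  have van: "eval_poly f (\<chi> n. \<tau> n * poly (Y n) z) = 0" for z
  proof -
    have "(\<chi> n. \<tau> n * poly (Y n) z) =
        (\<chi> n. \<tau> n * (if n = i then z else if n = j then z + A else if n = k then 1 else 1 + z))"
      by (auto simp: vec_eq_iff Y_def add.commute)
    then show ?thesis using nf(5)[rule_format] l(2) unfolding vanishes_on_def by simp
  qed
  have ne: "S \<noteq> {}" using \<open>S = range s'\<close> by simp
  obtain g where g: "\<forall>u\<in>S. g u \<noteq> 0 \<and> v (g u) = 0"
    "\<forall>e. small (\<Sum>u\<in>S. g u * coeff (\<Prod>n\<in>UNIV. Y n ^ (u $ n)) e)"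
    by (rule initial_form_vanishes[OF inf f(1) S_def nf(1,2)[THEN spec] Yint van ne]) (rule that)
  have Yv: "Y i = [:0, 1:]" "Y j = [:A, 1:]" "Y k = 1" "Y m = [:1, 1:]"
    using d by (auto simp: Y_def)
  have "(\<Prod>n\<in>UNIV. Y n ^ (s' q $ n)) =
      [:0, 1:] ^ (s q $ 1) * [:A, 1:] ^ (s q $ 2) * [:1, 1:] ^ (s q $ 3)" for q
    unfolding prod_UNIV_4_distinct[OF d] Yv s'_def by (simp add: \<pi>)
  then have "small (\<Sum>q\<in>UNIV. g (s' q) *
      coeff ([:0, 1:] ^ (s q $ 1) * [:A, 1:] ^ (s q $ 2) * [:1, 1:] ^ (s q $ 3)) e)" for e
    using g(2)[rule_format, of e] unfolding \<open>S = range s'\<close> by (simp add: sum.reindex[OF inj_vertex])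
  then show ?thesis using that[of A "\<lambda>n. g (s' n)"] A(1) g(1) \<open>S = range s'\<close> by blast
qed

end

theorem theorem2p6:
  fixes val :: "'k::alg_closed_field \<Rightarrow> real"
  assumes "is_valuation val"
  shows "holds_for_general_smooth_cubic (\<lambda>\<omega>.
    \<forall>L. (type_3I_1 \<omega> L \<and> ring_characteristic (residue_field val) \<noteq> 2) \<or> type_3I_2 \<omega> L \<longrightarrow>
      (\<forall>f :: (nat^4) \<Rightarrow>\<^sub>0 'k. homogeneous_of_degree 3 f \<and> trop_surface \<omega> = trop_hypersurface val f \<longrightarrow>
        (\<forall>a>0. \<not> (\<exists>l. projective_line l \<and> vanishes_on f l \<and> trop_of_line val l = L a))))"
proof -
  interpret valued_field val by unfold_locales (rule assms)
  have False
    if type: "(type_3I_1 \<omega> L \<and> ring_characteristic (residue_field val) \<noteq> 2) \<or> type_3I_2 \<omega> L"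
      and f: "homogeneous_of_degree 3 f" "trop_surface \<omega> = trop_hypersurface val f" and a: "a > 0"
      and l: "projective_line l" "vanishes_on f l" "trop_of_line val l = L a"
    for \<omega> L a l and f :: "(nat^4) \<Rightarrow>\<^sub>0 'k"
    using type
  proof (elim disjE conjE)
    assume 1: "type_3I_1 \<omega> L" "ring_characteristic (residue_field val) \<noteq> 2"
    obtain p i j k m \<pi> where "distinct [i, j, k, m]" "bij \<pi>" "\<pi> i = 1" "\<pi> j = 2" "\<pi> k = 0" "\<pi> m = 3"
      "dual_cell \<omega> p = permute_coordinates \<pi> ` range vertex_3I_1" "trop_of_line val l = tropical_line p a i j k m"
      using type_3I_normalized[OF 1(1)[unfolded type_3I_1_def]] l(3) a unfolding range_vertex_3I by (metis less_imp_le)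
    from residual_relation[OF infinite_UNIV_alg_closed frame_3I_1 this(1-7) f l(1,2) this(8) a]
    obtain A g where A: "small A" and g: "\<And>n. g n \<noteq> 0 \<and> val (g n) = 0"
      and rel: "\<And>e. small (\<Sum>n\<in>UNIV. g n * coeff ([:0, 1:] ^ (vertex_3I_1 n $ 1) *
         [:A, 1:] ^ (vertex_3I_1 n $ 2) * [:1, 1:] ^ (vertex_3I_1 n $ 3)) e)"
      by blast
    \<comment> \<open>The four monomials restrict to 1, 1 + z, z^2 (z + A) and z (1 + z)^2; only the
      last two contain z^2, with coefficients \<open>A\<close> and 2.\<close>
    have "small (A * g 2 + 2 * g 3)"
      using rel[of 2] by (simp add: sum_UNIV_4 vertex_3I_1_def numeral_2_eq_2 algebra_simps)
    moreover have "small (A * g 2)" using A g by (intro small_mult) (auto simp: integral_elt_def)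
    ultimately have "small (2 * g 3)" using small_diff by fastforce
    \<comment> \<open>\<open>g 3\<close> is a unit, so multiplying by it does not change the
      valuation of 2; if 2 = 0 in the field, 2 is small anyway.\<close>
    then have "small 2" using g[of 3] v_mult[of 2 "g 3"] by (cases "(2::'k) = 0") (auto simp: small_iff)
    then show False using two_not_small[OF 1(2)] by simp
  next
    assume 2: "type_3I_2 \<omega> L"
    obtain p i j k m \<pi> where "distinct [i, j, k, m]" "bij \<pi>" "\<pi> i = 1" "\<pi> j = 2" "\<pi> k = 0" "\<pi> m = 3"
      "dual_cell \<omega> p = permute_coordinates \<pi> ` range vertex_3I_2" "trop_of_line val l = tropical_line p a i j k m"
      using type_3I_normalized[OF 2[unfolded type_3I_2_def]] l(3) a unfolding range_vertex_3I by (metis less_imp_le)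
    from residual_relation[OF infinite_UNIV_alg_closed frame_3I_2 this(1-7) f l(1,2) this(8) a]
    obtain A g where A: "small A" and g: "\<And>n. g n \<noteq> 0 \<and> val (g n) = 0"
      and rel: "\<And>e. small (\<Sum>n\<in>UNIV. g n * coeff ([:0, 1:] ^ (vertex_3I_2 n $ 1) *
         [:A, 1:] ^ (vertex_3I_2 n $ 2) * [:1, 1:] ^ (vertex_3I_2 n $ 3)) e)"
      by blast
    \<comment> \<open>The last monomial now restricts to z (z + A) (1 + z), whose linear coefficient
      is \<open>A\<close>; the only other linear term is that of 1 + z.\<close>
    have "small (A * g 3 + g 1)"
      using rel[of 1] by (simp add: sum_UNIV_4 vertex_3I_2_def numeral_2_eq_2 algebra_simps)
    moreover have "small (A * g 3)" using A g by (intro small_mult) (auto simp: integral_elt_def)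
    ultimately have "small (g 1)" using small_diff by fastforce
    then show False using g[of 1] by (simp add: small_iff)
  qed
  then show ?thesis
    unfolding holds_for_general_smooth_cubic_def
  proof (intro allI impI exI conjI ballI notI)
    fix T
    show "openin (top_of_set (open_secondary_cone T)) (open_secondary_cone T)" by simp
    show "open_secondary_cone T \<subseteq> closure (open_secondary_cone T)" by (rule closure_subset)
  qed (elim conjE exE, blast)
qed

end
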